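(* Let $K$ be a given number field, and let $n=[K:\mathbb{Q}]$. Then the ring $\mathrm{Int}(M_n^K(\mathbb{Z}),M_n(\mathbb{Z}))$ is not integrally closed and its integral closure is $\mathrm{Int}_{\mathbb{Q}}(O_K)$.
   Context: $O_K$ is the ring of integers of $K$, and $\mathrm{Int}_{\mathbb{Q}}(O_K)=\{f\in\mathbb{Q}[X]\mid f(O_K)\subset O_K\}$. $M_n(\mathbb{Z})$ is the ring of $n\times n$ integer matrices, and for $\mathcal{M}\subseteq M_n(\mathbb{Z})$, $\mathrm{Int}(\mathcal{M},M_n(\mathbb{Z}))=\{f\in\mathbb{Q}[X]\mid f(M)\in M_n(\mathbb{Z})\ \text{for all } M\in\mathcal{M}\}$. $M_n^K(\mathbb{Z})$ is the set of matrices in $M_n(\mathbb{Z})$ whose characteristic polynomial is the minimal polynomial over $\mathbb{Q}$ of some element of $O_K$ of degree $n$ (equivalently, is irreducible and has a root in $K$). Integral closure is taken in the quotient field $\mathbb{Q}(X)$.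
   Formalization: "Not integrally closed" is asserted only for n ≥ 2: for K = Q (n = 1) the ring is Int(Z) = Int_Q(Z), which is integrally closed, so the claim fails there; the description of the integral closure is proved for every number field. *)

theory Defs
  imports
    Complex_Main
    "HOL-Computational_Algebra.Computational_Algebra"
    "Jordan_Normal_Form.Char_Poly"
begin

interpretation rat_vs: vector_space "\<lambda>(q::rat) (x::'a::field_char_0). of_rat q * x"
  by unfold_locales (simp_all add: algebra_simps of_rat_add of_rat_mult)

text \<open>A number field is a subfield of an arbitrary ambient field of characteristic 0 which has
  finite dimension over the rationals. The ambient field plays no further role; every number field
  arises in this way.\<close>

definition number_field :: "'a::field_char_0 set \<Rightarrow> bool" where
  "number_field K \<longleftrightarrow>
     0 \<in> K \<and> 1 \<in> K \<and>
     (\<forall>x\<in>K. \<forall>y\<in>K. x - y \<in> K \<and> x * y \<in> K) \<and>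
     (\<forall>x\<in>K. inverse x \<in> K) \<and>
     (\<exists>B. finite B \<and> rat_vs.span B = K)"

definition nf_degree :: "'a::field_char_0 set \<Rightarrow> nat" where
  "nf_degree K = rat_vs.dim K"

definition ring_of_integers :: "'a::field_char_0 set \<Rightarrow> 'a set" where
  "ring_of_integers K = {x \<in> K. algebraic_int x}"

definition is_min_poly_rat :: "rat poly \<Rightarrow> 'a::field_char_0 \<Rightarrow> bool" where
  "is_min_poly_rat p x \<longleftrightarrow>
     lead_coeff p = 1 \<and> poly (map_poly of_rat p) x = 0 \<and>
     (\<forall>q. q \<noteq> 0 \<and> poly (map_poly of_rat q) x = 0 \<longrightarrow> degree p \<le> degree q)"

definition Int_Q :: "'a::field_char_0 set \<Rightarrow> rat poly set" where
  "Int_Q R = {f. \<forall>x\<in>R. poly (map_poly of_rat f) x \<in> R}"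

text \<open>The value \<open>f(A)\<close> at an \<open>n \<times> n\<close> matrix \<open>A\<close>; the sum of the
  \<open>coeff f k \<cdot> A\<^sup>k\<close> is written out entrywise, because matrices of this type have no
  \<open>sum\<close> operator.\<close>

definition eval_poly_mat :: "nat \<Rightarrow> 'a::comm_ring_1 poly \<Rightarrow> 'a mat \<Rightarrow> 'a mat" where
  "eval_poly_mat n f A = mat n n (\<lambda>(i, j). \<Sum>k\<le>degree f. coeff f k * (A ^\<^sub>m k) $$ (i, j))"

definition Int_Mat :: "nat \<Rightarrow> int mat set \<Rightarrow> rat poly set" where
  "Int_Mat n S =
     {f. \<forall>M\<in>S. eval_poly_mat n f (map_mat rat_of_int M) \<in> map_mat rat_of_int ` carrier_mat n n}"

definition M_K :: "nat \<Rightarrow> 'a::field_char_0 set \<Rightarrow> int mat set" where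
  "M_K n K =
     {M \<in> carrier_mat n n. \<exists>p. \<exists>\<alpha>\<in>ring_of_integers K.
        is_min_poly_rat p \<alpha> \<and> degree p = n \<and> char_poly (map_mat rat_of_int M) = p}"

text \<open>The closure is taken in the ambient field \<open>'k\<close>, so \<open>integrally_closed R\<close> has its usual
  meaning only if \<open>'k\<close> is the quotient field of \<open>R\<close>. These notions are meant for
  \<open>'k = rat poly fract\<close>, the field of rational functions over the rationals, which is the quotient
  field of every ring of rational polynomials that contains all integer polynomials, such as
  \<open>Int_Mat n S\<close> for \<open>S \<subseteq> carrier_mat n n\<close>.\<close>

definition integral_over :: "'k::field set \<Rightarrow> 'k \<Rightarrow> bool" where
  "integral_over R x \<longleftrightarrow> (\<exists>p. lead_coeff p = 1 \<and> (\<forall>i. coeff p i \<in> R) \<and> poly p x = 0)"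

definition integral_closure :: "'k::field set \<Rightarrow> 'k set" where
  "integral_closure R = {x. integral_over R x}"

definition integrally_closed :: "'k::field set \<Rightarrow> bool" where
  "integrally_closed R \<longleftrightarrow> integral_closure R = R"

end

theory Submission
  imports Defs "HOL-Computational_Algebra.Field_as_Ring"
begin

text \<open>
  Let \<open>R\<close> be the ring of polynomials that are integer-valued on the matrices and \<open>O\<close> the ring of
  integers of \<open>K\<close>. Evaluating \<open>f \<in> R\<close> at the companion matrix of the minimal polynomial of some
  \<open>\<alpha> \<in> O\<close> of degree \<open>n\<close> shows \<open>f(\<alpha>) \<in> \<int>[\<alpha>]\<close>. Hence a polynomial \<open>g\<close> that is integral over \<open>R\<close> takes
  integral values at all elements of \<open>O\<close> of degree \<open>n\<close>. If \<open>d\<close> is a denominator of \<open>g\<close>, every residue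
  class modulo \<open>d O\<close> contains an element of degree \<open>n\<close>, so \<open>g\<close> is integer-valued on all of \<open>O\<close>.

  Conversely, let \<open>f\<close> be integer-valued on \<open>O\<close> with denominator \<open>d\<close>. For each of the matrices \<open>M\<close>, with
  eigenvalue \<open>\<alpha>\<close>, the Cayley-Hamilton theorem gives \<open>\<chi>(f(M)) = 0\<close> for a monic integer polynomial \<open>\<chi>\<close> of
  degree \<open>n\<close> with root \<open>f(\<alpha>)\<close>. The product \<open>\<Phi>\<close> of all monic polynomials of degree \<open>n\<close> with
  coefficients in \<open>[0, d\<^sup>n)\<close> is divisible by \<open>\<chi>\<close> modulo \<open>d\<^sup>n\<close>, hence \<open>\<Phi>(f) \<in> R\<close> and \<open>f\<close> is integral over
  \<open>R\<close>.

  Finally, let \<open>\<theta> \<in> O\<close> have degree \<open>n \<ge> 2\<close> and let \<open>q\<close> be a prime modulo which the minimal polynomial of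
  \<open>\<theta>\<close> is separable. Then \<open>O/qO\<close> is a quotient of \<open>\<int>[\<theta>]\<close> and reduced, so some power of its Frobenius map
  is the identity, and \<open>f = (X\<^sup>Q - X)/q\<close> is integer-valued on \<open>O\<close> for some power \<open>Q\<close> of \<open>q\<close>. But
  \<open>f(q \<theta>) \<notin> \<int>[q \<theta>]\<close>, as \<open>f\<close> has linear term \<open>- X/q\<close>.
\<close>

section \<open>Integrality\<close>

definition is_subring :: "'a::comm_ring_1 set \<Rightarrow> bool" where
  "is_subring S \<longleftrightarrow> 1 \<in> S \<and> (\<forall>x\<in>S. \<forall>y\<in>S. x - y \<in> S \<and> x * y \<in> S)"

lemma subring_one: "is_subring S \<Longrightarrow> 1 \<in> S"
  and subring_diff: "is_subring S \<Longrightarrow> x \<in> S \<Longrightarrow> y \<in> S \<Longrightarrow> x - y \<in> S"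
  and subring_mult: "is_subring S \<Longrightarrow> x \<in> S \<Longrightarrow> y \<in> S \<Longrightarrow> x * y \<in> S"
  by (auto simp: is_subring_def)

lemma subring_zero: "is_subring S \<Longrightarrow> 0 \<in> S"
  using subring_diff[of S 1 1] subring_one by auto

lemma subring_uminus: "is_subring S \<Longrightarrow> x \<in> S \<Longrightarrow> - x \<in> S"
  using subring_diff[of S 0 x] subring_zero by auto

lemma subring_add: "is_subring S \<Longrightarrow> x \<in> S \<Longrightarrow> y \<in> S \<Longrightarrow> x + y \<in> S"
  using subring_diff[of S x "- y"] subring_uminus by auto

lemma subring_power: "is_subring S \<Longrightarrow> x \<in> S \<Longrightarrow> x ^ k \<in> S"
  by (induction k) (auto intro: subring_one subring_mult)

lemma subring_sum: "is_subring S \<Longrightarrow> (\<And>i. i \<in> I \<Longrightarrow> f i \<in> S) \<Longrightarrow> sum f I \<in> S"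
  by (induction I rule: infinite_finite_induct) (auto intro: subring_zero subring_add)

lemma subring_of_nat: "is_subring S \<Longrightarrow> of_nat k \<in> S"
  by (induction k) (auto intro: subring_zero subring_one subring_add)

lemma subring_of_int: "is_subring S \<Longrightarrow> of_int k \<in> S"
  by (cases k rule: int_cases2) (auto intro: subring_of_nat subring_uminus)

lemma subring_poly:
  assumes "is_subring S" "\<And>i. coeff f i \<in> S" "x \<in> S"
  shows "poly f x \<in> S"
  unfolding poly_altdef using assms by (intro subring_sum subring_mult subring_power)

lemma subring_int_poly:
  assumes "is_subring S" "x \<in> S"
  shows "poly (map_poly of_int f) x \<in> S"
  using assms by (intro subring_poly) (auto simp: coeff_map_poly intro: subring_of_int)

lemma subring_coeff_mult:
  assumes "is_subring S" "\<And>i. coeff f i \<in> S" "\<And>i. coeff g i \<in> S"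
  shows "coeff (f * g) i \<in> S"
  unfolding coeff_mult using assms by (intro subring_sum subring_mult)

section \<open>Subrings with finitely generated additive group, as a criterion for
  integrality\<close>

interpretation zmod: Modules.module "\<lambda>(k::int) (x::'a::comm_ring_1). of_int k * x"
  by unfold_locales (simp_all add: algebra_simps)

text \<open>Finite generation refers to the additive group, not to the ring structure. Lying in such
  a subring serves as the working criterion for being an algebraic integer.\<close>

definition fg_subring :: "'a::comm_ring_1 set \<Rightarrow> bool" where
  "fg_subring S \<longleftrightarrow> is_subring S \<and> (\<exists>B. finite B \<and> S = zmod.span B)"

text \<open>Multiplication by \<open>x\<close> acts on generators of the module through an integer matrix, which
  has \<open>x\<close> as an eigenvalue.\<close>

lemma fg_subring_algebraic_int:
  fixes x :: "'a::field_char_0"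
  assumes "fg_subring S" "x \<in> S"
  shows "algebraic_int x"
proof -
  from assms obtain B where B: "finite B" "S = zmod.span B" and sub: "is_subring S"
    by (auto simp: fg_subring_def)
  obtain bs where bs: "set bs = B" "distinct bs"
    using finite_distinct_list[OF B(1)] by auto
  define n where "n = length bs"
  have "\<exists>u. x * b = (\<Sum>c\<in>B. of_int (u c) * c)" if "b \<in> B" for b
  proof -
    have "x * b \<in> zmod.span B"
      using that assms(2) sub B(2) zmod.span_base[of b B] subring_mult by metis
    thus ?thesis unfolding zmod.span_finite[OF B(1)] by auto
  qed
  then obtain u where u: "x * b = (\<Sum>c\<in>B. of_int (u b c) * c)" if "b \<in> B" for b
    by metis
  define A where "A = mat n n (\<lambda>(i, j). u (bs ! i) (bs ! j))"
  have A: "A \<in> carrier_mat n n" by (simp add: A_def)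
  define v where "v = vec n (\<lambda>i. bs ! i)"
  have v: "v \<in> carrier_vec n" by (simp add: v_def)
  \<comment> \<open>The vector of generators is nonzero, since otherwise \<open>S\<close> would be
    zero and could not contain \<open>1\<close>.\<close>
  have "v \<noteq> 0\<^sub>v n"
  proof
    assume "v = 0\<^sub>v n"
    hence "bs ! i = 0" if "i < n" for i
      using that by (metis v_def index_vec index_zero_vec(1))
    hence "B \<subseteq> {0}" using bs by (auto simp: in_set_conv_nth n_def)
    hence "S \<subseteq> {0}" unfolding B(2)
      by (intro zmod.span_minimal) (auto simp: zmod.subspace_def)
    thus False using subring_one[OF sub] by auto
  qed
  moreover have "map_mat of_int A *\<^sub>v v = x \<cdot>\<^sub>v v"
  proof (rule eq_vecI)
    fix i assume "i < dim_vec (x \<cdot>\<^sub>v v)"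
    hence i: "i < n" by (simp add: v_def)
    have "(map_mat of_int A *\<^sub>v v) $ i = (\<Sum>j<n. of_int (u (bs ! i) (bs ! j)) * bs ! j)"
      using i by (auto simp: A_def v_def scalar_prod_def lessThan_atLeast0 intro!: sum.cong)
    also have "\<dots> = (\<Sum>c\<in>B. of_int (u (bs ! i) c) * c)"
      by (rule sum.reindex_bij_betw[of "(!) bs" "{..<n}" B "\<lambda>c. of_int (u (bs ! i) c) * c"])
        (use bij_betw_nth[OF bs(2), of "{..<n}" B] bs(1) in \<open>simp add: n_def\<close>)
    also have "\<dots> = x * bs ! i"
      using u[of "bs ! i"] i bs(1) nth_mem[of i bs] by (simp add: n_def)
    finally show "(map_mat of_int A *\<^sub>v v) $ i = (x \<cdot>\<^sub>v v) $ i"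
      using i by (simp add: v_def)
  qed (simp add: v_def A_def)
  ultimately have "eigenvalue (map_mat of_int A) x"
    unfolding eigenvalue_def eigenvector_def using v A by (intro exI[of _ v]) auto
  hence "poly (char_poly (map_mat of_int A)) x = 0"
    using eigenvalue_root_char_poly[of "map_mat of_int A" n x] A by auto
  hence "poly (map_poly of_int (char_poly A)) x = 0"
    by (simp add: of_int_hom.char_poly_hom[OF A])
  moreover have "lead_coeff (char_poly A) = 1"
    using degree_monic_char_poly[OF A] by auto
  ultimately show ?thesis
    by (auto simp: algebraic_int_altdef_ipoly)
qed

text \<open>\<open>T\<close> is the ring \<open>S[y]\<close>. Its additive group is generated by the
  products of generators of \<open>S\<close> with powers of \<open>y\<close> below the degree of
  \<open>p\<close>, because \<open>p\<close> is monic.\<close>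

lemma fg_subring_adjoin:
  assumes S: "fg_subring S" and p: "lead_coeff p = 1" "\<And>i. coeff p i \<in> S" "poly p y = 0"
  shows "\<exists>T. fg_subring T \<and> S \<subseteq> T \<and> y \<in> T"
proof -
  from S obtain B where B: "finite B" "S = zmod.span B" and sub: "is_subring S"
    by (auto simp: fg_subring_def)
  define T where "T = {poly f y |f. \<forall>i. coeff f i \<in> S}"
  define D where "D = degree p"
  define B' where "B' = (\<lambda>(b, k). b * y ^ k) ` (B \<times> {..<D})"
  have TI: "poly f y \<in> T" if "\<And>i. coeff f i \<in> S" for f
    using that by (auto simp: T_def)
  have ST: "S \<subseteq> T"
  proof
    fix s assume "s \<in> S"
    thus "s \<in> T"
      using TI[of "[:s:]"] by (auto simp: coeff_pCons subring_zero[OF sub] split: nat.splits)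
  qed
  have y: "y \<in> T"
    using TI[of "[:0, 1:]"]
    by (auto simp: coeff_pCons subring_zero[OF sub] subring_one[OF sub] split: nat.splits)
  have subT: "is_subring T"
    unfolding is_subring_def
  proof (intro conjI ballI)
    show "1 \<in> T" using ST subring_one[OF sub] by auto
    fix x x' assume "x \<in> T" "x' \<in> T"
    then obtain f g where "x = poly f y" "x' = poly g y"
      and fg: "\<And>i. coeff f i \<in> S" "\<And>i. coeff g i \<in> S"
      by (auto simp: T_def)
    thus "x - x' \<in> T" "x * x' \<in> T"
      using TI[of "f - g"] TI[of "f * g"]
      by (auto simp: subring_diff[OF sub] subring_coeff_mult[OF sub])
  qed
  \<comment> \<open>By strong induction on \<open>k\<close>: for \<open>k \<ge> D\<close> the monic
    equation rewrites \<open>y ^ k\<close> into lower powers with coefficients in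
    \<open>S\<close>.\<close>
  have pow: "\<forall>s\<in>S. s * y ^ k \<in> zmod.span B'" for k
  proof (induction k rule: less_induct)
    case (less k)
    show ?case
    proof
      fix s assume s: "s \<in> S"
      show "s * y ^ k \<in> zmod.span B'"
      proof (cases "k < D")
        case True
        from s have "s \<in> zmod.span B" using B by simp
        thus ?thesis
        proof (induction rule: zmod.span_induct_alt)
          case base
          show ?case by (simp add: zmod.span_zero)
        next
          case (step c x z)
          have "x * y ^ k \<in> zmod.span B'"
            using step True by (intro zmod.span_base) (auto simp: B'_def)
          thus ?case
            using step zmod.span_add[OF zmod.span_scale[of "x * y ^ k" B' c]]
            by (auto simp: algebra_simps)
        qed
      next
        case False
        have "0 = (\<Sum>i\<le>D. coeff p i * y ^ i)"
          using p(3) by (simp add: poly_altdef D_def)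
        also have "\<dots> = (\<Sum>i<D. coeff p i * y ^ i) + y ^ D"
          using p(1) by (simp add: D_def lessThan_Suc_atMost[symmetric])
        finally have yD: "y ^ D = - (\<Sum>i<D. coeff p i * y ^ i)"
          by (simp add: eq_neg_iff_add_eq_0 add.commute)
        have "s * y ^ k = s * y ^ (k - D) * y ^ D"
          using False by (simp add: mult.assoc power_add[symmetric])
        also have "\<dots> = (\<Sum>i<D. - (s * coeff p i) * y ^ (k - D + i))"
          by (simp add: yD sum_distrib_left power_add mult_ac sum_negf)
        also have "\<dots> \<in> zmod.span B'"
        proof (rule zmod.span_sum)
          fix i assume "i \<in> {..<D}"
          hence "k - D + i < k" using False by auto
          thus "- (s * coeff p i) * y ^ (k - D + i) \<in> zmod.span B'"
            using less s p(2) by (intro less(1)[rule_format] subring_uminus[OF sub] subring_mult[OF sub])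
        qed
        finally show ?thesis .
      qed
    qed
  qed
  have "T \<subseteq> zmod.span B'"
  proof
    fix x assume "x \<in> T"
    then obtain f where "x = poly f y" "\<And>i. coeff f i \<in> S" by (auto simp: T_def)
    thus "x \<in> zmod.span B'"
      using pow by (auto simp: poly_altdef intro!: zmod.span_sum)
  qed
  moreover have "zmod.span B' \<subseteq> T"
  proof (rule zmod.span_minimal)
    show "B' \<subseteq> T"
      using ST y B zmod.span_base
      by (auto simp: B'_def intro!: subring_mult[OF subT] subring_power[OF subT])
    show "zmod.subspace T"
      unfolding zmod.subspace_def
      using subring_zero[OF subT] subring_add[OF subT] subring_mult[OF subT] subring_of_int[OF subT]
      by blast
  qed
  moreover have "finite B'" using B by (simp add: B'_def)
  ultimately have "fg_subring T" using subT by (auto simp: fg_subring_def)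
  thus ?thesis using ST y by blast
qed

text \<open>The elements are adjoined one at a time, starting from the integers, which are generated
  by \<open>1\<close>.\<close>

lemma algebraic_ints_in_fg_subring:
  fixes C :: "'a::field_char_0 set"
  assumes "finite C" "\<And>x. x \<in> C \<Longrightarrow> algebraic_int x"
  shows "\<exists>S. fg_subring S \<and> C \<subseteq> S"
  using assms
proof (induction C rule: finite_induct)
  case empty
  have "zmod.span {1} = (range of_int :: 'a set)"
    by (simp add: zmod.span_singleton)
  moreover have "is_subring (range of_int :: 'a set)"
    by (auto simp: is_subring_def simp flip: of_int_diff of_int_mult intro!: range_eqI[of _ _ 1])
  ultimately show ?case
    by (intro exI[of _ "range of_int"]) (auto simp: fg_subring_def intro!: exI[of _ "{1}"])
next
  case (insert x C)
  then obtain S where S: "fg_subring S" "C \<subseteq> S" by auto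
  from insert have "algebraic_int x" by auto
  then obtain p where p: "lead_coeff p = 1" "\<forall>i. coeff p i \<in> \<int>" "poly p x = 0"
    by (auto simp: algebraic_int.simps)
  have "coeff p i \<in> S" for i
    using p(2) S(1) subring_of_int by (auto simp: fg_subring_def Ints_def elim!: allE[of _ i])
  from fg_subring_adjoin[OF S(1) p(1) this p(3)] show ?case using S by blast
qed

text \<open>Transitivity of integrality: finitely many coefficients lie in a common
  \<open>fg_subring\<close>, to which \<open>y\<close> is then adjoined.\<close>

lemma integral_over_algebraic_ints:
  fixes y :: "'a::field_char_0"
  assumes p: "lead_coeff p = 1" "\<And>i. algebraic_int (coeff p i)" "poly p y = 0"
  shows "algebraic_int y"
proof -
  have "\<exists>S. fg_subring S \<and> coeff p ` {..degree p} \<subseteq> S"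
    using p by (intro algebraic_ints_in_fg_subring) auto
  then obtain S where S: "fg_subring S" "\<And>i. i \<le> degree p \<Longrightarrow> coeff p i \<in> S" by blast
  have "coeff p i \<in> S" for i
    using S subring_zero[of S] by (cases "i \<le> degree p") (auto simp: fg_subring_def coeff_eq_0)
  from fg_subring_adjoin[OF S(1) p(1) this p(3)] fg_subring_algebraic_int
  show ?thesis by blast
qed

lemma is_subring_algebraic_int: "is_subring {x::'a::field_char_0. algebraic_int x}"
  unfolding is_subring_def
proof (intro conjI ballI)
  fix x y :: 'a
  assume "x \<in> {x. algebraic_int x}" "y \<in> {x. algebraic_int x}"
  then obtain S where S: "fg_subring S" "{x, y} \<subseteq> S"
    using algebraic_ints_in_fg_subring[of "{x, y}"] by auto
  hence "x - y \<in> S" "x * y \<in> S"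
    by (auto simp: fg_subring_def intro: subring_diff subring_mult)
  thus "x - y \<in> {x. algebraic_int x}" "x * y \<in> {x. algebraic_int x}"
    using fg_subring_algebraic_int[OF S(1)] by auto
qed auto

section \<open>Minimal polynomials and number fields\<close>

abbreviation rpoly :: "rat poly \<Rightarrow> 'a::field_char_0 \<Rightarrow> 'a" where
  "rpoly f x \<equiv> poly (map_poly of_rat f) x"

interpretation of_rat_poly: map_poly_idom_hom "of_rat :: rat \<Rightarrow> 'a::field_char_0" ..

lemma rpoly_of_int_poly: "rpoly (map_poly of_int f) x = poly (map_poly of_int f) x"
  by (simp add: map_poly_map_poly o_def)

lemma rpoly_add: "rpoly (f + g) x = rpoly f x + rpoly g x"
  and rpoly_diff: "rpoly (f - g) x = rpoly f x - rpoly g x"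
  and rpoly_mult: "rpoly (f * g) x = rpoly f x * rpoly g x"
  and rpoly_smult: "rpoly (Polynomial.smult c f) x = of_rat c * rpoly f x"
  by (simp_all add: of_rat_poly.hom_add of_rat_poly.hom_minus of_rat_poly.hom_mult
      of_rat_hom.map_poly_hom_smult)

lemma rpoly_pcompose: "rpoly (pcompose f g) x = rpoly f (rpoly g x)"
  by (simp add: of_rat_hom.map_poly_pcompose poly_pcompose)

lemma rpoly_altdef: "degree f \<le> N \<Longrightarrow> rpoly f x = (\<Sum>i\<le>N. of_rat (coeff f i) * x ^ i)"
  unfolding poly_altdef by (intro sum.mono_neutral_cong_left) (auto simp: coeff_map_poly coeff_eq_0)

lemma rpoly_mod: "rpoly p x = 0 \<Longrightarrow> rpoly (f mod p) x = rpoly f x"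
  by (simp only: minus_div_mult_eq_mod[symmetric] rpoly_diff rpoly_mult) simp

lemma rat_poly_clear_denominators: "\<exists>d>0. \<exists>g. Polynomial.smult (of_int d) f = map_poly rat_of_int g"
proof (induction f)
  case 0
  show ?case by (intro exI[of _ 1] conjI exI[of _ 0]) auto
next
  case (pCons a f)
  then obtain d g where d: "d > 0" "Polynomial.smult (of_int d) f = map_poly rat_of_int g" by blast
  obtain k l where a: "a = of_int k / of_int l" "l > 0"
    by (cases a) (auto simp: Fract_of_int_quotient)
  have dk: "of_int l * of_int d * a = of_int (d * k)" using a by simp
  have dl: "of_int (d * l) = (of_int l * of_int d :: rat)" by simp
  have "Polynomial.smult (of_int (d * l)) (pCons a f)
      = pCons (of_int (d * k)) (Polynomial.smult (of_int l) (Polynomial.smult (of_int d) f))"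
    by (simp only: smult_pCons dk smult_smult dl)
  also have "\<dots> = map_poly rat_of_int (pCons (d * k) (Polynomial.smult l g))"
    by (simp only: d(2) of_int_hom.map_poly_pCons_hom of_int_hom.map_poly_hom_smult)
  finally show ?case using d(1) a(2) by (intro exI[of _ "d * l"]) auto
qed

text \<open>Independence of an indexed family instead of a set: a family with a repeated member
  counts as dependent.\<close>

definition rat_indep :: "(nat \<Rightarrow> 'a::field_char_0) \<Rightarrow> nat \<Rightarrow> bool" where
  "rat_indep b N \<longleftrightarrow> (\<forall>e. (\<Sum>i<N. of_rat (e i) * b i) = 0 \<longrightarrow> (\<forall>i<N. e i = 0))"

lemma rat_indep_inj_on: 
  assumes "rat_indep b N"
  shows "inj_on b {..<N}"
proof (rule inj_onI, rule ccontr)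
  fix i j assume ij: "i \<in> {..<N}" "j \<in> {..<N}" "b i = b j" "i \<noteq> j"
  define e :: "nat \<Rightarrow> rat" where "e = (\<lambda>k. if k = i then 1 else if k = j then -1 else 0)"
  have "(\<Sum>k<N. of_rat (e k) * b k) = (\<Sum>k<N. (if k = i then b i else 0) - (if k = j then b j else 0))"
    using ij by (intro sum.cong) (auto simp: e_def)
  also have "\<dots> = 0"
    using ij by (simp add: sum_subtractf)
  finally have "e i = 0" using assms ij by (auto simp: rat_indep_def)
  thus False by (simp add: e_def)
qed

lemma rat_indep_independent:
  assumes "rat_indep b N"
  shows "rat_vs.independent (b ` {..<N})"
proof
  assume "rat_vs.dependent (b ` {..<N})"
  then obtain u where u: "\<exists>v\<in>b ` {..<N}. u v \<noteq> 0" "(\<Sum>v\<in>b ` {..<N}. of_rat (u v) * v) = 0"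
    by (subst (asm) rat_vs.dependent_finite) auto
  from u(2) have "(\<Sum>i<N. of_rat (u (b i)) * b i) = 0"
    by (subst (asm) sum.reindex[OF rat_indep_inj_on[OF assms]]) simp
  hence "\<forall>i<N. u (b i) = 0"
    using assms unfolding rat_indep_def by (elim allE[of _ "\<lambda>i. u (b i)"]) auto
  thus False using u(1) by auto
qed

section \<open>Minimal polynomials over the rationals\<close>

lemma is_min_poly_rat_exists:
  assumes "f \<noteq> 0" "rpoly f x = 0"
  shows "\<exists>p. is_min_poly_rat p x \<and> degree p \<le> degree f"
proof -
  define P where "P = (\<lambda>q. q \<noteq> 0 \<and> rpoly q x = 0)"
  define q where "q = (ARG_MIN degree q. P q)"
  have "P f" using assms by (simp add: P_def)
  hence q: "P q" "\<And>r. P r \<Longrightarrow> degree q \<le> degree r"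
    unfolding q_def by (auto intro: arg_min_natI arg_min_nat_le)
  have "is_min_poly_rat (Polynomial.smult (inverse (lead_coeff q)) q) x"
    using q unfolding is_min_poly_rat_def by (auto simp: P_def rpoly_smult)
  thus ?thesis using q \<open>P f\<close> by (intro exI[of _ "Polynomial.smult (inverse (lead_coeff q)) q"]) (auto simp: P_def)
qed

lemma is_min_poly_rat_unique_small:
  assumes "is_min_poly_rat p x" "rpoly f x = 0" "degree f < degree p"
  shows "f = 0"
proof (rule ccontr)
  assume "f \<noteq> 0"
  hence "degree p \<le> degree f"
    using assms(1,2) unfolding is_min_poly_rat_def by blast
  thus False using assms(3) by simp
qed

lemma is_min_poly_rat_dvd:
  assumes p: "is_min_poly_rat p x" and f: "rpoly f x = 0"
  shows "p dvd f"
proof -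
  have p0: "p \<noteq> 0" "rpoly p x = 0" using p by (auto simp: is_min_poly_rat_def)
  have "rpoly (f mod p) x = 0" using f p0 by (simp add: rpoly_mod)
  hence "f mod p = 0"
    using is_min_poly_rat_unique_small[OF p, of "f mod p"] degree_mod_less[OF p0(1), of f] by blast
  thus ?thesis by auto
qed

lemma is_min_poly_rat_degree_pos:
  assumes "is_min_poly_rat p x"
  shows "degree p > 0"
proof (rule ccontr)
  assume "\<not> degree p > 0"
  then obtain c where "p = [:c:]" by (auto elim: degree_eq_zeroE)
  thus False using assms by (auto simp: is_min_poly_rat_def)
qed

lemma is_min_poly_rat_reduce:
  assumes p: "is_min_poly_rat p x"
  shows "\<exists>g. degree g < degree p \<and> rpoly g x = rpoly f x"
proof -
  have p0: "p \<noteq> 0" "rpoly p x = 0" using p by (auto simp: is_min_poly_rat_def)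
  have "rpoly (f mod p) x = rpoly f x" using p0 by (simp add: rpoly_mod)
  moreover have "degree (f mod p) < degree p"
    using degree_mod_less[OF p0(1), of f] is_min_poly_rat_degree_pos[OF p] by auto
  ultimately show ?thesis by blast
qed

lemma is_min_poly_rat_eqI:
  assumes p: "is_min_poly_rat p x" and f: "lead_coeff f = 1" "degree f \<le> degree p" "rpoly f x = 0"
  shows "f = p"
proof -
  obtain k where k: "f = p * k" using is_min_poly_rat_dvd[OF p f(3)] by (auto elim: dvdE)
  have "p \<noteq> 0" "k \<noteq> 0" using f(1) k by auto
  hence "degree k = 0" using f(2) by (simp add: k degree_mult_eq)
  then obtain c where "k = [:c:]" by (auto elim: degree_eq_zeroE)
  moreover have "lead_coeff k = 1"
    using f(1) p by (simp add: k lead_coeff_mult is_min_poly_rat_def)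
  ultimately show ?thesis by (simp add: k)
qed

lemma rat_indep_powers:
  assumes p: "is_min_poly_rat p x"
  shows "rat_indep (\<lambda>i. x ^ i) (degree p)"
  unfolding rat_indep_def
proof safe
  fix e i assume e: "(\<Sum>i<degree p. of_rat (e i) * x ^ i) = 0" and i: "i < degree p"
  define f where "f = (\<Sum>i<degree p. monom (e i) i)"
  have coeff: "coeff f i = (if i < degree p then e i else 0)" for i
    by (simp add: f_def coeff_sum)
  have deg: "degree f < degree p"
    using is_min_poly_rat_degree_pos[OF p] by (intro degree_lessI) (auto simp: coeff)
  have "rpoly f x = (\<Sum>i\<le>degree p. of_rat (coeff f i) * x ^ i)"
    using deg by (intro rpoly_altdef) auto
  also have "\<dots> = 0" using e by (simp add: coeff lessThan_Suc_atMost[symmetric])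
  finally have "f = 0" using is_min_poly_rat_unique_small[OF p _ deg] by auto
  thus "e i = 0" using coeff[of i] i by simp
qed

text \<open>A relation with nonzero coefficient at \<open>y\<close> would make \<open>y\<close> a
  polynomial in \<open>x\<close>; otherwise it is a relation between powers of \<open>x\<close>
  below the degree.\<close>

lemma rat_indep_extend:
  assumes p: "is_min_poly_rat p x" and y: "\<And>f. y \<noteq> rpoly f x"
  shows "rat_indep (\<lambda>i. if i < degree p then x ^ i else y) (Suc (degree p))"
  unfolding rat_indep_def
proof (rule allI, rule impI)
  fix e
  define m where "m = degree p"
  assume "(\<Sum>i<Suc (degree p). of_rat (e i) * (if i < degree p then x ^ i else y)) = 0"
  hence e: "(\<Sum>i<m. of_rat (e i) * x ^ i) + of_rat (e m) * y = 0" by (simp add: m_def)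
  define f where "f = (\<Sum>i<m. monom (e i) i)"
  have coeff: "coeff f i = (if i < m then e i else 0)" for i by (simp add: f_def coeff_sum)
  have "rpoly f x = (\<Sum>i\<le>m. of_rat (coeff f i) * x ^ i)"
    by (intro rpoly_altdef degree_le) (auto simp: coeff)
  also have "\<dots> = (\<Sum>i<m. of_rat (e i) * x ^ i)"
    by (simp add: coeff lessThan_Suc_atMost[symmetric])
  finally have f: "rpoly f x + of_rat (e m) * y = 0" using e by simp
  have em: "e m = 0"
  proof (rule ccontr)
    assume "e m \<noteq> 0"
    hence "y = of_rat (- inverse (e m)) * rpoly f x"
      using f unfolding of_rat_minus of_rat_hom.hom_inverse
      by (simp add: add_eq_0_iff divide_simps mult.commute)
    hence "y = rpoly (Polynomial.smult (- inverse (e m)) f) x" by (simp only: rpoly_smult)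
    thus False using y by blast
  qed
  hence "\<forall>i<m. e i = 0"
    using rat_indep_powers[OF p] e by (auto simp: rat_indep_def m_def)
  thus "\<forall>i<Suc (degree p). e i = 0" using em by (auto simp: less_Suc_eq m_def)
qed

text \<open>Gauss's lemma: once denominators are cleared in a factorization of a monic integer
  polynomial, multiplicativity of the content forces the content of \<open>P\<close> to equal its
  denominator \<open>d\<close>.\<close>

lemma is_min_poly_rat_int:
  assumes p: "is_min_poly_rat p x" and x: "algebraic_int x"
  shows "\<exists>P. p = map_poly of_int P \<and> lead_coeff P = 1 \<and> degree P = degree p"
proof -
  from x obtain Q where Q: "poly (map_poly of_int Q) x = 0" "lead_coeff Q = 1"
    by (auto simp: algebraic_int_altdef_ipoly)
  have "p dvd map_poly of_int Q"
    using Q by (intro is_min_poly_rat_dvd[OF p]) (simp add: rpoly_of_int_poly)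
  then obtain h where h: "map_poly rat_of_int Q = p * h" by (auto elim: dvdE)
  obtain d P where P: "d > 0" "Polynomial.smult (of_int d) p = map_poly rat_of_int P"
    using rat_poly_clear_denominators[of p] by blast
  obtain d' H where H: "d' > 0" "Polynomial.smult (of_int d') h = map_poly rat_of_int H"
    using rat_poly_clear_denominators[of h] by blast
  have p1: "lead_coeff p = 1" using p by (simp add: is_min_poly_rat_def)
  hence h1: "lead_coeff h = 1"
    using arg_cong[OF h, of lead_coeff] Q(2) by (simp add: lead_coeff_mult)
  \<comment> \<open>As \<open>p\<close> and \<open>h\<close> are monic, the denominators reappear as
    leading coefficients, so they bound the contents.\<close>
  have leadP: "lead_coeff P = d" and leadH: "lead_coeff H = d'"
    using arg_cong[OF P(2), of lead_coeff] arg_cong[OF H(2), of lead_coeff] p1 h1 P(1) H(1)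
    by (simp_all add: lead_coeff_smult)
  have "map_poly rat_of_int (Polynomial.smult (d * d') Q) = map_poly rat_of_int (P * H)"
    by (simp add: of_int_hom.map_poly_hom_smult h of_int_poly_hom.hom_mult mult.commute flip: P(2) H(2))
  hence "content (Polynomial.smult (d * d') Q) = content (P * H)"
    by (metis of_int_poly_hom.eq_iff)
  moreover have "content Q = 1"
    using content_dvd_coeff[of Q "degree Q"] Q(2) by (metis is_unit_content_iff normalize_content)
  ultimately have c: "content P * content H = d * d'"
    using P(1) H(1) by (simp add: content_mult)
  have "content P dvd d" "content H dvd d'"
    using leadP leadH content_dvd_coeff by metis+
  hence "content P \<le> d" "content H \<le> d'"
    using P(1) H(1) by (auto intro: zdvd_imp_le)
  moreover have "content P \<ge> 0"
    using normalize_content[of P] by simp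
  ultimately have "d * d' \<le> content P * d'"
    unfolding c[symmetric] by (intro mult_left_mono)
  hence "content P = d"
    using \<open>content P \<le> d\<close> H(1) by (simp add: mult_right_le_imp_le)
  hence "P = Polynomial.smult d (primitive_part P)"
    using content_times_primitive_part[of P] by simp
  hence dp: "Polynomial.smult (of_int d) p = Polynomial.smult (of_int d) (map_poly rat_of_int (primitive_part P))"
    using P(2) by (metis of_int_hom.map_poly_hom_smult)
  have "p = Polynomial.smult (inverse (of_int d)) (Polynomial.smult (of_int d) p)"
    using P(1) by simp
  also have "\<dots> = map_poly rat_of_int (primitive_part P)"
    unfolding dp using P(1) by simp
  finally have "p = map_poly rat_of_int (primitive_part P)" .
  thus ?thesis using p1 by (intro exI[of _ "primitive_part P"]) auto
qed

text \<open>A common divisor of \<open>p\<close> and \<open>f\<close> does not vanish at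
  \<open>x\<close>, so its cofactor in \<open>p\<close> does; by minimality the cofactor has full
  degree and the divisor is constant.\<close>

lemma is_min_poly_rat_bezout:
  assumes p: "is_min_poly_rat p x" and f: "rpoly f x \<noteq> 0"
  shows "\<exists>u v. u * p + v * f = 1"
proof -
  have "coprime p f"
  proof (rule coprimeI)
    fix c assume c: "c dvd p" "c dvd f"
    then obtain k l where kl: "p = c * k" "f = c * l" by (auto elim!: dvdE)
    have "rpoly c x \<noteq> 0" using f by (auto simp: kl rpoly_mult)
    moreover have "rpoly p x = 0" using p by (auto simp: is_min_poly_rat_def)
    ultimately have "rpoly k x = 0" by (auto simp: kl rpoly_mult)
    hence "p dvd k" by (rule is_min_poly_rat_dvd[OF p])
    moreover have "k \<noteq> 0" "c \<noteq> 0" using kl p by (auto simp: is_min_poly_rat_def)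
    ultimately have "degree p \<le> degree k" by (auto intro: dvd_imp_degree_le)
    hence "degree c = 0" using \<open>k \<noteq> 0\<close> \<open>c \<noteq> 0\<close> by (simp add: kl degree_mult_eq)
    thus "c dvd 1" using \<open>c \<noteq> 0\<close> by (simp add: is_unit_iff_degree)
  qed
  hence "fst (bezout_coefficients p f) * p + snd (bezout_coefficients p f) * f = 1"
    using bezout_coefficients_fst_snd[of p f] by simp
  thus ?thesis by blast
qed

text \<open>In characteristic 0 the derivative is nonzero and of smaller degree than
  \<open>p\<close>.\<close>

lemma is_min_poly_rat_pderiv:
  assumes p: "is_min_poly_rat p x"
  shows "rpoly (pderiv p) x \<noteq> 0"
  using is_min_poly_rat_unique_small[OF p, of "pderiv p"] is_min_poly_rat_degree_pos[OF p]
  by (auto simp: degree_pderiv pderiv_eq_0_iff)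

section \<open>Degrees and denominators of elements of a number field\<close>

locale number_field_locale =
  fixes K :: "'a::field_char_0 set" and n :: nat
  assumes number_field: "number_field K" and degree: "n = nf_degree K"
begin

abbreviation "O\<^sub>K \<equiv> ring_of_integers K"

lemma subring_K: "is_subring K"
  using number_field by (auto simp: number_field_def is_subring_def)

lemma of_rat_in_K: "of_rat q \<in> K"
proof (cases q)
  case (Fract a b)
  have "of_int a * inverse (of_int b) \<in> K"
    using number_field subring_K by (auto simp: number_field_def intro: subring_mult subring_of_int)
  thus ?thesis using Fract by (simp add: of_rat_rat divide_inverse)
qed

lemma rpoly_in_K: "x \<in> K \<Longrightarrow> rpoly f x \<in> K"
  using subring_K by (intro subring_poly) (auto simp: coeff_map_poly of_rat_in_K)

lemma is_subring_ring_of_integers: "is_subring O\<^sub>K"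
  using subring_K is_subring_algebraic_int
  unfolding is_subring_def ring_of_integers_def by blast

lemma ring_of_integersD: "x \<in> O\<^sub>K \<Longrightarrow> x \<in> K" "x \<in> O\<^sub>K \<Longrightarrow> algebraic_int x"
  by (auto simp: ring_of_integers_def)

lemma finite_basis:
  obtains B where "B \<subseteq> K" "rat_vs.independent B" "K \<subseteq> rat_vs.span B" "finite B" "card B = n"
proof -
  obtain B where B: "B \<subseteq> K" "rat_vs.independent B" "K \<subseteq> rat_vs.span B" "card B = n"
    using rat_vs.basis_exists[of K] by (metis degree nf_degree_def)
  obtain B' where "finite B'" "rat_vs.span B' = K"
    using number_field by (auto simp: number_field_def)
  hence "finite B" using rat_vs.independent_span_bound[of B' B] B by auto
  thus ?thesis using that B by auto
qed

lemma rat_indep_le_degree: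
  assumes "rat_indep b N" "\<And>i. i < N \<Longrightarrow> b i \<in> K"
  shows "N \<le> n"
proof -
  obtain B where B: "K \<subseteq> rat_vs.span B" "finite B" "card B = n" by (rule finite_basis)
  have "card (b ` {..<N}) \<le> card B"
    using rat_vs.independent_span_bound[OF B(2) rat_indep_independent[OF assms(1)]] assms(2) B(1)
    by blast
  thus ?thesis using B(3) by (simp add: card_image rat_indep_inj_on[OF assms(1)])
qed

lemma is_min_poly_rat_degree_le:
  assumes "is_min_poly_rat p x" "x \<in> K"
  shows "degree p \<le> n"
  using rat_indep_le_degree[OF rat_indep_powers[OF assms(1)]] assms(2)
  by (auto intro: subring_power[OF subring_K])

text \<open>The \<open>n + 1\<close> powers of \<open>x\<close> up to \<open>x ^ n\<close> are
  dependent, and a relation between them is an annihilating polynomial.\<close>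

lemma min_poly_exists_K:
  assumes x: "x \<in> K"
  shows "\<exists>p. is_min_poly_rat p x"
proof -
  have "\<not> rat_indep (\<lambda>i. x ^ i) (Suc n)"
    using rat_indep_le_degree[of "\<lambda>i. x ^ i" "Suc n"] subring_power[OF subring_K x] by auto
  then obtain e i where e: "(\<Sum>i<Suc n. of_rat (e i) * x ^ i) = 0" "i < Suc n" "e i \<noteq> 0"
    unfolding rat_indep_def by blast
  define f where "f = (\<Sum>i<Suc n. monom (e i) i)"
  have coeff: "coeff f i = (if i < Suc n then e i else 0)" for i
    unfolding f_def coeff_sum coeff_monom by simp
  have "degree f \<le> n" by (intro degree_le) (auto simp: coeff)
  hence "rpoly f x = (\<Sum>i\<le>n. of_rat (coeff f i) * x ^ i)" by (rule rpoly_altdef)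
  also have "\<dots> = 0" using e(1) by (simp add: coeff lessThan_Suc_atMost)
  finally have "rpoly f x = 0" .
  moreover have "f \<noteq> 0" using coeff[of i] e by auto
  ultimately show ?thesis using is_min_poly_rat_exists by blast
qed

text \<open>Otherwise \<open>y\<close> together with the first \<open>n\<close> powers of
  \<open>x\<close> would give \<open>n + 1\<close> independent elements of \<open>K\<close>.\<close>

lemma degree_n_generates:
  assumes p: "is_min_poly_rat p x" "degree p = n" and x: "x \<in> K" and y: "y \<in> K"
  shows "\<exists>f. y = rpoly f x"
proof (rule ccontr)
  assume "\<not> ?thesis"
  hence "rat_indep (\<lambda>i. if i < n then x ^ i else y) (Suc n)"
    using rat_indep_extend[OF p(1), of y] p(2) by simp
  moreover have "(if i < n then x ^ i else y) \<in> K" for i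
    using x y subring_power[OF subring_K] by auto
  ultimately show False using rat_indep_le_degree[of "\<lambda>i. if i < n then x ^ i else y" "Suc n"] by auto
qed

lemma small_degree_not_generates:
  assumes p: "is_min_poly_rat p x" "degree p < n" and x: "x \<in> K"
  shows "\<exists>y\<in>K. \<forall>f. y \<noteq> rpoly f x"
proof (rule ccontr)
  assume "\<not> ?thesis"
  hence *: "\<exists>f. y = rpoly f x" if "y \<in> K" for y using that by auto
  have "K \<subseteq> rat_vs.span ((\<lambda>i. x ^ i) ` {..<degree p})"
  proof
    fix y assume "y \<in> K"
    then obtain f where f: "degree f < degree p" "y = rpoly f x"
      using * is_min_poly_rat_reduce[OF p(1)] by metis
    have "rpoly f x = (\<Sum>i\<le>degree f. of_rat (coeff f i) * x ^ i)" by (intro rpoly_altdef) simp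
    also have "\<dots> \<in> rat_vs.span ((\<lambda>i. x ^ i) ` {..<degree p})"
      using f(1) by (intro rat_vs.span_sum rat_vs.span_scale rat_vs.span_base) auto
    finally show "y \<in> rat_vs.span ((\<lambda>i. x ^ i) ` {..<degree p})" using f by simp
  qed
  hence "n \<le> card ((\<lambda>i. x ^ i) ` {..<degree p})"
    unfolding degree nf_degree_def by (intro rat_vs.dim_le_card) auto
  also have "\<dots> \<le> degree p" using card_image_le[of "{..<degree p}"] by simp
  finally show False using p by simp
qed

lemma integral_multiple:
  assumes x: "x \<in> K"
  shows "\<exists>d>0. of_int d * x \<in> O\<^sub>K"
proof -
  obtain p where p: "is_min_poly_rat p x" using min_poly_exists_K[OF x] by blast
  obtain d g where d: "d > 0" "Polynomial.smult (of_int d) p = map_poly of_int g"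
    using rat_poly_clear_denominators[of p] by blast
  define m where "m = degree p"
  \<comment> \<open>This is \<open>d ^ m * p(X / d)\<close>, which vanishes at \<open>d * x\<close>.
    Below the leading term, one factor \<open>d\<close> turns the coefficient of \<open>p\<close>
    into that of \<open>g\<close>; the remaining exponent is \<open>m - Suc i\<close>.\<close>
  define h where "h = (\<Sum>i<m. monom (of_int (coeff g i * d ^ (m - Suc i))) i) + (monom 1 m :: 'a poly)"
  have coeff: "coeff h i = (if i < m then of_int (coeff g i * d ^ (m - Suc i)) else if i = m then 1 else 0)" for i
    unfolding h_def by (simp add: coeff_sum)
  have "degree h = m"
    by (intro antisym degree_le le_degree) (auto simp: coeff)
  have "rpoly p x * of_int d ^ m = (\<Sum>i\<le>m. of_rat (coeff p i) * x ^ i * of_int d ^ m)"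
    by (subst rpoly_altdef[of p m]) (auto simp: m_def sum_distrib_right)
  also have "\<dots> = (\<Sum>i\<le>m. coeff h i * (of_int d * x) ^ i)"
  proof (rule sum.cong)
    fix i assume i: "i \<in> {..m}"
    have "of_int d * coeff p i = of_int (coeff g i)"
      using arg_cong[OF d(2), of "\<lambda>f. coeff f i"] by (simp add: coeff_map_poly)
    hence *: "of_int d * of_rat (coeff p i) = (of_int (coeff g i) :: 'a)"
      by (metis of_rat_mult of_rat_of_int_eq)
    show "of_rat (coeff p i) * x ^ i * of_int d ^ m = coeff h i * (of_int d * x) ^ i"
    proof (cases "i = m")
      case True
      have "coeff p m = 1" using p by (simp add: m_def is_min_poly_rat_def)
      thus ?thesis using True by (simp add: coeff power_mult_distrib)
    next
      case False
      hence im: "i < m" using i by simp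
      have "of_int d ^ m = (of_int d * of_int d ^ (m - Suc i) * of_int d ^ i :: 'a)"
        using im by (simp flip: power_Suc power_add)
      hence "of_rat (coeff p i) * x ^ i * of_int d ^ m
          = (of_int d * of_rat (coeff p i)) * of_int d ^ (m - Suc i) * (of_int d ^ i * x ^ i)"
        by (simp add: mult_ac)
      thus ?thesis using im * by (simp add: coeff power_mult_distrib)
    qed
  qed simp
  also have "\<dots> = poly h (of_int d * x)"
    using \<open>degree h = m\<close> by (simp add: poly_altdef)
  finally have "poly h (of_int d * x) = 0" using p by (simp add: is_min_poly_rat_def)
  moreover have "lead_coeff h = 1" using \<open>degree h = m\<close> by (simp add: coeff)
  moreover have "\<forall>i. coeff h i \<in> \<int>" by (auto simp: coeff)
  ultimately have "algebraic_int (of_int d * x)" by (intro algebraic_int.intros)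
  moreover have "of_int d * x \<in> K"
    using subring_K x by (intro subring_mult subring_of_int)
  ultimately show ?thesis using d(1) by (auto simp: ring_of_integers_def)
qed

end

section \<open>Elements of full degree in residue classes\<close>

definition rat_linear :: "('a::field_char_0 \<Rightarrow> rat) \<Rightarrow> bool" where
  "rat_linear \<phi> \<longleftrightarrow> (\<forall>x y. \<phi> (x + y) = \<phi> x + \<phi> y) \<and> (\<forall>q x. \<phi> (of_rat q * x) = q * \<phi> x)"

lemma rat_linear_zero: "rat_linear \<phi> \<Longrightarrow> \<phi> 0 = 0"
  unfolding rat_linear_def by (metis add_cancel_right_left)

lemma rat_linear_sum:
  assumes "rat_linear \<phi>"
  shows "\<phi> (\<Sum>i\<in>I. of_rat (e i) * x i) = (\<Sum>i\<in>I. e i * \<phi> (x i))"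
  using assms
  by (induction I rule: infinite_finite_induct) (auto simp: rat_linear_zero, auto simp: rat_linear_def)

text \<open>Powers of a rational \<open>t\<close> are scalars and pass through \<phi>. Coordinates
  of \<open>poly W (of_rat t)\<close> thereby become polynomial functions of
  \<open>t\<close>.\<close>

lemma rat_linear_poly:
  assumes "rat_linear \<phi>"
  shows "poly (map_poly \<phi> W) t = \<phi> (poly W (of_rat t))"
proof (induction W)
  case 0
  show ?case using rat_linear_zero[OF assms] by simp
next
  case (pCons a W)
  thus ?case using assms by (simp add: map_poly_pCons rat_linear_zero[OF assms] rat_linear_def)
qed

text \<open>The family is extended to a basis of the ambient field, and \<phi> consists of its
  coordinate functions.\<close>

lemma rat_indep_dual:
  assumes b: "rat_indep b N"
  shows "\<exists>\<phi>. (\<forall>j. rat_linear (\<phi> j)) \<and> (\<forall>i<N. \<forall>j<N. \<phi> j (b i) = (if i = j then 1 else 0))"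
proof -
  define E where "E = rat_vs.extend_basis (b ` {..<N})"
  have E: "rat_vs.independent E" "rat_vs.span E = UNIV" "b ` {..<N} \<subseteq> E"
    unfolding E_def using rat_indep_independent[OF b]
    by (auto simp: rat_vs.independent_extend_basis rat_vs.span_extend_basis
        intro: rat_vs.extend_basis_superset[THEN subsetD])
  define \<phi> where "\<phi> = (\<lambda>j x. rat_vs.representation E x (b j))"
  have "rat_linear (\<phi> j)" for j
    using E(1,2) by (auto simp: rat_linear_def \<phi>_def rat_vs.representation_add rat_vs.representation_scale)
  moreover have "\<phi> j (b i) = (if i = j then 1 else 0)" if "i < N" "j < N" for i j
  proof -
    have "\<phi> j (b i) = (if b j = b i then 1 else 0)"
      using E that by (auto simp: \<phi>_def rat_vs.representation_basis[OF E(1)])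
    thus ?thesis using inj_onD[OF rat_indep_inj_on[OF b], of i j] that by auto
  qed
  ultimately show ?thesis by blast
qed

text \<open>The determinant of the coordinates is a polynomial in \<open>t\<close> that does not vanish at \<open>0\<close>, hence
  it vanishes at finitely many \<open>t\<close> only.\<close>

lemma rat_indep_perturb:
  fixes W :: "nat \<Rightarrow> 'a::field_char_0 poly"
  assumes "rat_indep (\<lambda>i. poly (W i) 0) N"
  shows "\<exists>t::nat. t > 0 \<and> rat_indep (\<lambda>i. poly (W i) (of_nat t)) N"
proof -
  from rat_indep_dual[OF assms] obtain \<phi> where lin: "\<And>j. rat_linear (\<phi> j)"
    and dual: "\<And>i j. i < N \<Longrightarrow> j < N \<Longrightarrow> \<phi> j (poly (W i) 0) = (if i = j then 1 else 0)"
    by blast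
  define A where "A = mat N N (\<lambda>(j, i). map_poly (\<phi> j) (W i))"
  have A: "A \<in> carrier_mat N N" by (simp add: A_def)
  have entry: "poly (A $$ (j, i)) t = \<phi> j (poly (W i) (of_rat t))" if "i < N" "j < N" for i j t
    using that by (simp add: A_def rat_linear_poly[OF lin])
  have "poly (det A) 0 = det (1\<^sub>m N :: rat mat)"
    using dual by (intro poly_det_cong[of _ N] A) (auto simp: entry)
  hence "det A \<noteq> 0" by auto
  hence "finite {t. poly (det A) t = 0}" by (rule poly_roots_finite)
  \<comment> \<open>Only positive integers are offered as candidates, because \<open>t > 0\<close>
    is part of the claim.\<close>
  moreover have "infinite (range (\<lambda>k. rat_of_nat (Suc k)))"
    by (rule range_inj_infinite) (auto intro: injI)
  ultimately have "\<not> range (\<lambda>k. rat_of_nat (Suc k)) \<subseteq> {t. poly (det A) t = 0}"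
    using finite_subset by blast
  then obtain k where k: "poly (det A) (rat_of_nat (Suc k)) \<noteq> 0" by blast
  define t where "t = Suc k"
  define At where "At = mat N N (\<lambda>(j, i). \<phi> j (poly (W i) (of_nat t)))"
  have At: "At \<in> carrier_mat N N" by (simp add: At_def)
  have "poly (det A) (of_nat t) = det At"
    by (intro poly_det_cong[of _ N] A At) (auto simp: entry At_def)
  hence det: "det At \<noteq> 0" using k by (simp add: t_def)
  have "rat_indep (\<lambda>i. poly (W i) (of_nat t)) N"
    unfolding rat_indep_def
  proof (rule allI, rule impI, rule ccontr)
    fix e :: "nat \<Rightarrow> rat"
    assume e: "(\<Sum>i<N. of_rat (e i) * poly (W i) (of_nat t)) = 0" "\<not> (\<forall>i<N. e i = 0)"
    \<comment> \<open>Applying every functional to a rational relation shows that its coefficients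
      form a kernel vector of \<open>At\<close>.\<close>
    have "At *\<^sub>v vec N e = 0\<^sub>v N"
    proof (rule eq_vecI)
      fix j assume "j < dim_vec (0\<^sub>v N :: rat vec)"
      hence j: "j < N" by simp
      have "(At *\<^sub>v vec N e) $ j = (\<Sum>i<N. e i * \<phi> j (poly (W i) (of_nat t)))"
        using j by (auto simp: At_def scalar_prod_def lessThan_atLeast0 mult.commute intro!: sum.cong)
      also have "\<dots> = \<phi> j (\<Sum>i<N. of_rat (e i) * poly (W i) (of_nat t))"
        by (rule rat_linear_sum[OF lin, symmetric])
      also have "\<dots> = 0" unfolding e by (rule rat_linear_zero[OF lin])
      finally show "(At *\<^sub>v vec N e) $ j = (0\<^sub>v N :: rat vec) $ j" using j by simp
    qed (simp add: At_def)
    moreover have "vec N e \<noteq> 0\<^sub>v N"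
    proof
      assume "vec N e = 0\<^sub>v N"
      hence "e i = 0" if "i < N" for i using that by (metis index_vec index_zero_vec(1))
      thus False using e(2) by blast
    qed
    ultimately show False
      using det det_0_iff_vec_prod_zero[OF At] vec_carrier[of N e] by blast
  qed
  thus ?thesis by (intro exI[of _ t]) (auto simp: t_def)
qed

context number_field_locale
begin

lemma rpoly_eq_sum: "rpoly f x = (\<Sum>i<N. of_rat (coeff f i) * x ^ i)" if "degree f < N"
proof -
  obtain M where "N = Suc M" using \<open>degree f < N\<close> by (cases N) auto
  thus ?thesis using that rpoly_altdef[of f M x] by (simp add: lessThan_Suc_atMost)
qed

text \<open>If \<open>\<theta>\<close> has degree \<open>m < n\<close> and \<open>\<gamma>\<close> is not a polynomial in \<open>\<theta>\<close>, then for some \<open>t\<close> the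
  powers up to \<open>m\<close> of \<open>\<theta> + t \<gamma>\<close> are independent: to first order in \<open>t\<close>, the value of the minimal
  polynomial \<open>p\<close> of \<open>\<theta>\<close> is \<open>t p'(\<theta>) \<gamma>\<close>.\<close>

lemma degree_increases:
  assumes p: "is_min_poly_rat p \<theta>" and \<gamma>: "\<And>f. \<gamma> \<noteq> rpoly f \<theta>"
  shows "\<exists>t::nat. \<forall>q. is_min_poly_rat q (\<theta> + of_nat t * \<gamma>) \<longrightarrow> degree p < degree q"
proof -
  define m where "m = degree p"
  define L where "L = [:\<theta>, \<gamma>:]"
  define P where "P = pcompose (map_poly of_rat p) L"
  have "poly P 0 = 0" using p by (simp add: P_def L_def poly_pcompose is_min_poly_rat_def)
  \<comment> \<open>\<open>P\<close> is \<open>p(\<theta> + X \<gamma>)\<close>. Dividing out its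
    root at 0 leaves \<open>V\<close>, whose value at 0 is the derivative term.\<close>
  then obtain V where V: "P = [:0, 1:] * V" by (auto simp: poly_eq_0_iff_dvd elim: dvdE)
  have "poly (pderiv P) 0 = rpoly (pderiv p) \<theta> * \<gamma>"
    by (simp add: P_def L_def pderiv_pcompose poly_pcompose of_rat_hom.map_poly_pderiv pderiv_pCons)
  moreover have "poly (pderiv P) 0 = poly V 0"
    unfolding V by (simp add: pderiv_mult pderiv_pCons)
  ultimately have V0: "poly V 0 = rpoly (pderiv p) \<theta> * \<gamma>" by simp
  \<comment> \<open>The value \<open>p'(\<theta>)\<close> has an inverse that is a polynomial in
    \<theta>, so multiplying by it does not move \<gamma> into the rational polynomials in
    \<theta>.\<close>
  have not: "rpoly (pderiv p) \<theta> * \<gamma> \<noteq> rpoly f \<theta>" for f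
  proof
    assume f: "rpoly (pderiv p) \<theta> * \<gamma> = rpoly f \<theta>"
    obtain u v where uv: "u * p + v * pderiv p = 1"
      using is_min_poly_rat_bezout[OF p is_min_poly_rat_pderiv[OF p]] by blast
    have "rpoly v \<theta> * rpoly (pderiv p) \<theta> = 1"
      using arg_cong[OF uv, of "\<lambda>f. rpoly f \<theta>"] p
      by (simp add: rpoly_add rpoly_mult is_min_poly_rat_def)
    hence "\<gamma> = rpoly (v * f) \<theta>" by (simp add: rpoly_mult f[symmetric] flip: mult.assoc)
    thus False using \<gamma> by blast
  qed
  \<comment> \<open>In the last place \<open>V\<close> replaces \<open>L ^ m\<close>, whose value at
    0 would depend on the lower powers.\<close>
  define W where "W = (\<lambda>i. if i < m then L ^ i else V)"
  have "(\<lambda>i. poly (W i) 0) = (\<lambda>i. if i < m then \<theta> ^ i else rpoly (pderiv p) \<theta> * \<gamma>)"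
    by (auto simp: W_def L_def V0 fun_eq_iff)
  hence "rat_indep (\<lambda>i. poly (W i) 0) (Suc m)"
    using rat_indep_extend[OF p not] by (simp add: m_def)
  from rat_indep_perturb[OF this] obtain t :: nat
    where t: "t > 0" "rat_indep (\<lambda>i. poly (W i) (of_nat t)) (Suc m)" by blast
  define \<theta>' where "\<theta>' = \<theta> + of_nat t * \<gamma>"
  have L': "poly L (of_nat t) = \<theta>'" by (simp add: L_def \<theta>'_def)
  have p\<theta>': "rpoly p \<theta>' = of_nat t * poly V (of_nat t)"
    using arg_cong[OF V, of "\<lambda>f. poly f (of_nat t)"] by (simp add: P_def poly_pcompose L')
  have "degree p < degree q" if q: "is_min_poly_rat q \<theta>'" for q
  proof (rule ccontr)
    assume "\<not> ?thesis"
    hence deg: "degree q \<le> m" by (simp add: m_def)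
    \<comment> \<open>Removing the coefficient of degree \<open>m\<close> by means of
      \<open>p\<close> turns \<open>q\<close> into a relation between the values of \<open>W\<close>
      at \<open>t\<close>, since \<open>p(\<theta>') = t * V(t)\<close>.\<close>
    define f where "f = q - Polynomial.smult (coeff q m) p"
    have "coeff f m = 0" using p by (simp add: f_def m_def is_min_poly_rat_def)
    moreover have "degree f \<le> m"
      unfolding f_def using deg by (intro degree_diff_le) (auto simp: m_def)
    ultimately have degf: "degree f < m"
      using is_min_poly_rat_degree_pos[OF p] m_def by (metis eq_zero_or_degree_less degree_0 le_neq_implies_less)
    define e where "e = (\<lambda>i. if i < m then coeff f i else coeff q m * of_nat t)"
    have "(\<Sum>i<Suc m. of_rat (e i) * poly (W i) (of_nat t)) =
        (\<Sum>i<m. of_rat (coeff f i) * \<theta>' ^ i) + of_rat (coeff q m) * (of_nat t * poly V (of_nat t))"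
      by (simp add: e_def W_def L' of_rat_mult mult.assoc)
    also have "\<dots> = rpoly f \<theta>' + rpoly (Polynomial.smult (coeff q m) p) \<theta>'"
      by (simp add: rpoly_eq_sum[OF degf, symmetric] p\<theta>' rpoly_smult)
    also have "\<dots> = rpoly q \<theta>'" by (simp add: f_def flip: rpoly_add)
    also have "\<dots> = 0" using q by (simp add: is_min_poly_rat_def)
    finally have e0: "\<forall>i<Suc m. e i = 0" using t(2) unfolding rat_indep_def by blast
    hence "e m = 0" by blast
    hence "coeff q m = 0" using t(1) by (simp add: e_def)
    moreover have "coeff f i = 0" if "i < m" for i
      using e0[rule_format, of i] that by (simp add: e_def)
    hence "f = 0" using degf by (metis leading_coeff_0_iff)
    ultimately have "q = 0" by (simp add: f_def)
    thus False using q by (simp add: is_min_poly_rat_def)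
  qed
  thus ?thesis unfolding \<theta>'_def by blast
qed

text \<open>An element of maximal degree in the class has degree \<open>n\<close>: otherwise a
  perturbation inside the class would raise its degree.\<close>

lemma generator_in_residue_class:
  assumes \<alpha>: "\<alpha> \<in> O\<^sub>K" and d: "d > (0::int)"
  shows "\<exists>\<gamma>\<in>O\<^sub>K. \<exists>p. is_min_poly_rat p (\<alpha> + of_int d * \<gamma>) \<and> degree p = n"
proof -
  note OK = is_subring_ring_of_integers
  define Q where "Q = (\<lambda>k. \<exists>\<gamma>\<in>O\<^sub>K. \<exists>p. is_min_poly_rat p (\<alpha> + of_int d * \<gamma>) \<and> degree p = k)"
  have mem: "\<alpha> + of_int d * \<gamma> \<in> O\<^sub>K" if "\<gamma> \<in> O\<^sub>K" for \<gamma>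
    using that \<alpha> OK by (intro subring_add subring_mult subring_of_int)
  obtain p0 where "is_min_poly_rat p0 (\<alpha> + of_int d * 0)"
    using min_poly_exists_K ring_of_integersD(1)[OF \<alpha>] by fastforce
  hence "Q (degree p0)" using subring_zero[OF OK] unfolding Q_def by blast
  moreover have "\<forall>k. Q k \<longrightarrow> k < Suc n"
    using is_min_poly_rat_degree_le mem ring_of_integersD(1) by (fastforce simp: Q_def less_Suc_eq_le)
  ultimately obtain m where m: "Q m" "\<And>k. Q k \<Longrightarrow> k \<le> m"
    using ex_has_greatest_nat[of Q "degree p0" "\<lambda>k. k" "Suc n"] by auto
  then obtain \<delta> p where \<delta>: "\<delta> \<in> O\<^sub>K" "is_min_poly_rat p (\<alpha> + of_int d * \<delta>)" "degree p = m"
    by (auto simp: Q_def)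
  define \<theta> where "\<theta> = \<alpha> + of_int d * \<delta>"
  have "\<theta> \<in> K" using mem[OF \<delta>(1)] ring_of_integersD by (simp add: \<theta>_def)
  have "m = n"
  proof (rule ccontr)
    assume "m \<noteq> n"
    hence "degree p < n"
      using is_min_poly_rat_degree_le[OF \<delta>(2)] \<delta>(3) \<open>\<theta> \<in> K\<close> by (simp add: \<theta>_def)
    then obtain y where y: "y \<in> K" "\<And>f. y \<noteq> rpoly f \<theta>"
      using small_degree_not_generates[of p \<theta>] \<delta>(2) \<open>\<theta> \<in> K\<close> \<theta>_def by blast
    obtain c where c: "c > 0" "of_int c * y \<in> O\<^sub>K" using integral_multiple[OF y(1)] by blast
    \<comment> \<open>The factor \<open>c\<close> makes \<open>y\<close> integral, and the factor
      \<open>d\<close> keeps the perturbed element in the residue class.\<close>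
    define \<gamma> where "\<gamma> = of_int d * (of_int c * y)"
    have "\<gamma> \<noteq> rpoly f \<theta>" for f
    proof
      assume "\<gamma> = rpoly f \<theta>"
      hence "of_int (d * c) * y = rpoly f \<theta>"
        by (simp only: \<gamma>_def of_int_mult mult.assoc)
      moreover have "y = inverse (of_int (d * c)) * (of_int (d * c) * y)"
        using c(1) d by (subst mult.assoc[symmetric], subst left_inverse) auto
      ultimately have "y = rpoly (Polynomial.smult (inverse (of_int (d * c))) f) \<theta>"
        by (simp only: rpoly_smult of_rat_hom.hom_inverse of_rat_of_int_eq)
      thus False using y(2) by blast
    qed
    then obtain t :: nat where t: "\<And>q. is_min_poly_rat q (\<theta> + of_nat t * \<gamma>) \<Longrightarrow> degree p < degree q"
      using degree_increases[of p \<theta> \<gamma>] \<delta>(2) \<theta>_def by blast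
    define \<delta>' where "\<delta>' = \<delta> + of_nat t * (of_int c * y)"
    have \<delta>': "\<delta>' \<in> O\<^sub>K"
      unfolding \<delta>'_def by (intro subring_add[OF OK] subring_mult[OF OK, of "of_nat t"] subring_of_nat[OF OK] \<delta>(1) c(2))
    have eq: "\<theta> + of_nat t * \<gamma> = \<alpha> + of_int d * \<delta>'"
      unfolding \<theta>_def \<gamma>_def \<delta>'_def
      by (simp only: distrib_left add.assoc mult.left_commute[of "of_int d" "of_nat t"])
    obtain q where q: "is_min_poly_rat q (\<alpha> + of_int d * \<delta>')"
      using min_poly_exists_K[OF ring_of_integersD(1)[OF mem[OF \<delta>']]] by blast
    hence "Q (degree q)" using \<delta>' unfolding Q_def by blast
    hence "degree q \<le> m" by (rule m(2))
    moreover have "degree p < degree q" using t q by (simp add: eq)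
    ultimately show False using \<delta>(3) by simp
  qed
  thus ?thesis using \<delta> by blast
qed

end

section \<open>Polynomials in matrices\<close>

lemma eval_poly_mat_carrier [simp]: "eval_poly_mat n f A \<in> carrier_mat n n"
  and eval_poly_mat_dim [simp]: "dim_row (eval_poly_mat n f A) = n" "dim_col (eval_poly_mat n f A) = n"
  by (simp_all add: eval_poly_mat_def)

text \<open>Provides a common summation bound for polynomials of different degrees.\<close>

lemma eval_poly_mat_index:
  assumes "degree f \<le> N" "i < n" "j < n"
  shows "eval_poly_mat n f A $$ (i, j) = (\<Sum>k\<le>N. coeff f k * (A ^\<^sub>m k) $$ (i, j))"
proof -
  have "(\<Sum>k\<le>degree f. coeff f k * (A ^\<^sub>m k) $$ (i, j)) = (\<Sum>k\<le>N. coeff f k * (A ^\<^sub>m k) $$ (i, j))"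
    using assms(1) by (intro sum.mono_neutral_left) (auto simp: coeff_eq_0)
  thus ?thesis using assms(2,3) by (simp add: eval_poly_mat_def)
qed

lemma eval_poly_mat_add:
  "eval_poly_mat n (f + g) A = eval_poly_mat n f A + eval_poly_mat n g A"
proof (rule eq_matI)
  fix i j assume "i < dim_row (eval_poly_mat n f A + eval_poly_mat n g A)"
    "j < dim_col (eval_poly_mat n f A + eval_poly_mat n g A)"
  hence ij: "i < n" "j < n" by auto
  define N where "N = max (degree f) (degree g)"
  have "degree (f + g) \<le> N" "degree f \<le> N" "degree g \<le> N"
    unfolding N_def by (auto intro: degree_add_le_max)
  thus "eval_poly_mat n (f + g) A $$ (i, j) = (eval_poly_mat n f A + eval_poly_mat n g A) $$ (i, j)"
    using ij by (simp add: eval_poly_mat_index[of _ N] sum.distrib distrib_right)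
qed auto

lemma eval_poly_mat_smult:
  "eval_poly_mat n (Polynomial.smult c f) A = c \<cdot>\<^sub>m eval_poly_mat n f A"
proof (rule eq_matI)
  fix i j assume "i < dim_row (c \<cdot>\<^sub>m eval_poly_mat n f A)" "j < dim_col (c \<cdot>\<^sub>m eval_poly_mat n f A)"
  hence ij: "i < n" "j < n" by auto
  show "eval_poly_mat n (Polynomial.smult c f) A $$ (i, j) = (c \<cdot>\<^sub>m eval_poly_mat n f A) $$ (i, j)"
    using ij degree_smult_le[of c f]
    by (simp add: eval_poly_mat_index[of _ "degree f"] sum_distrib_left mult.assoc)
qed auto

lemma pow_mat_Suc_left: "A \<in> carrier_mat n n \<Longrightarrow> A ^\<^sub>m Suc k = A * A ^\<^sub>m k"
proof (induction k)
  case (Suc k)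
  have "A ^\<^sub>m Suc (Suc k) = (A * A ^\<^sub>m k) * A" using Suc by simp
  also have "\<dots> = A * (A ^\<^sub>m k * A)"
    using Suc by (intro assoc_mult_mat[of _ n n _ n _ n]) auto
  finally show ?case by simp
qed auto

lemma eval_poly_mat_pCons_0:
  assumes A: "A \<in> carrier_mat n n"
  shows "eval_poly_mat n (pCons 0 f) A = A * eval_poly_mat n f A"
proof (rule eq_matI)
  fix i j assume "i < dim_row (A * eval_poly_mat n f A)" "j < dim_col (A * eval_poly_mat n f A)"
  hence ij: "i < n" "j < n" using A by auto
  have "eval_poly_mat n (pCons 0 f) A $$ (i, j)
      = (\<Sum>k\<le>Suc (degree f). coeff (pCons 0 f) k * (A ^\<^sub>m k) $$ (i, j))"
    using ij by (intro eval_poly_mat_index) auto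
  also have "\<dots> = (\<Sum>k\<le>degree f. coeff f k * (A ^\<^sub>m Suc k) $$ (i, j))"
    unfolding sum.atMost_Suc_shift by simp
  also have "\<dots> = (\<Sum>k\<le>degree f. coeff f k * (\<Sum>l<n. A $$ (i, l) * (A ^\<^sub>m k) $$ (l, j)))"
    unfolding pow_mat_Suc_left[OF A]
    using ij A by (intro sum.cong refl) (auto simp: scalar_prod_def lessThan_atLeast0 intro!: sum.cong)
  also have "\<dots> = (\<Sum>l<n. A $$ (i, l) * (\<Sum>k\<le>degree f. coeff f k * (A ^\<^sub>m k) $$ (l, j)))"
    unfolding sum_distrib_left by (subst sum.swap) (simp add: mult_ac)
  also have "\<dots> = (A * eval_poly_mat n f A) $$ (i, j)"
    using ij A by (auto simp: scalar_prod_def lessThan_atLeast0 eval_poly_mat_def intro!: sum.cong)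
  finally show "eval_poly_mat n (pCons 0 f) A $$ (i, j) = (A * eval_poly_mat n f A) $$ (i, j)" .
qed (use A in auto)

lemma eval_poly_mat_0: "eval_poly_mat n 0 A = 0\<^sub>m n n"
  by (auto simp: eval_poly_mat_def)

lemma eval_poly_mat_mult:
  assumes A: "A \<in> carrier_mat n n"
  shows "eval_poly_mat n (f * g) A = eval_poly_mat n f A * eval_poly_mat n g A"
proof (induction f)
  case 0
  show ?case by (simp add: eval_poly_mat_0)
next
  case (pCons a f)
  let ?e = "\<lambda>f. eval_poly_mat n f A"
  have const: "?e [:a:] = a \<cdot>\<^sub>m 1\<^sub>m n"
    using A by (auto simp: eval_poly_mat_def)
  have split: "pCons a f = [:a:] + pCons 0 f" by simp
  have "?e (pCons a f * g) = ?e (Polynomial.smult a g + pCons 0 (f * g))" by simp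
  also have "\<dots> = a \<cdot>\<^sub>m ?e g + A * (?e f * ?e g)"
    by (simp only: eval_poly_mat_add eval_poly_mat_smult eval_poly_mat_pCons_0[OF A] pCons.IH)
  also have "\<dots> = (a \<cdot>\<^sub>m 1\<^sub>m n) * ?e g + (A * ?e f) * ?e g"
    using A by (simp add: mult_smult_assoc_mat[of _ n n _ n] assoc_mult_mat[of _ n n _ n _ n])
  also have "\<dots> = (a \<cdot>\<^sub>m 1\<^sub>m n + A * ?e f) * ?e g"
    using A by (intro add_mult_distrib_mat[symmetric, of _ n n _ _ n]) auto
  also have "\<dots> = ?e (pCons a f) * ?e g"
    unfolding split by (simp only: eval_poly_mat_add const eval_poly_mat_pCons_0[OF A])
  finally show ?case .
qed

text \<open>Comparing coefficients in \<open>(X - A) adj (X - A) = \<chi>\<close> makes \<open>\<Sum> \<chi>\<^sub>k A\<^sup>k\<close> a telescoping sum.\<close>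

theorem cayley_hamilton:
  assumes A: "A \<in> carrier_mat n n"
  shows "eval_poly_mat n (char_poly A) A = 0\<^sub>m n n"
proof -
  let ?\<chi> = "char_poly A"
  define C where "C = char_poly_matrix A"
  have C: "C \<in> carrier_mat n n" using A by (simp add: C_def)
  define B where "B = adj_mat C"
  have B: "B \<in> carrier_mat n n" unfolding B_def by (rule adj_mat(1)[OF C])
  have CB: "C * B = ?\<chi> \<cdot>\<^sub>m 1\<^sub>m n"
    unfolding B_def char_poly_def C_def[symmetric] by (rule adj_mat(2)[OF C])
  \<comment> \<open>The coefficient matrix of the adjugate at the \<open>k\<close>-th power of the
    indeterminate.\<close>
  define Bk where "Bk = (\<lambda>k. mat n n (\<lambda>(i, j). coeff (B $$ (i, j)) k))"
  have Bk: "Bk k \<in> carrier_mat n n" for k by (simp add: Bk_def)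
  have coeff: "coeff ?\<chi> k * (if i = j then 1 else 0)
      = coeff (pCons 0 (B $$ (i, j))) k - (A * Bk k) $$ (i, j)" if ij: "i < n" "j < n" for i j k
  proof -
    have "?\<chi> * (if i = j then 1 else 0) = (C * B) $$ (i, j)"
      unfolding CB using ij by simp
    also have "\<dots> = (\<Sum>l<n. C $$ (i, l) * B $$ (l, j))"
      using ij B C by (auto simp: scalar_prod_def lessThan_atLeast0 intro!: sum.cong)
    also have "\<dots> = (\<Sum>l<n. (if l = i then pCons 0 (B $$ (l, j)) else 0)
        - Polynomial.smult (A $$ (i, l)) (B $$ (l, j)))"
      using ij A by (intro sum.cong refl) (auto simp: C_def char_poly_matrix_def)
    also have "\<dots> = pCons 0 (B $$ (i, j)) - (\<Sum>l<n. Polynomial.smult (A $$ (i, l)) (B $$ (l, j)))"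
      using ij by (simp add: sum_subtractf)
    finally have "coeff (?\<chi> * (if i = j then 1 else 0)) k
        = coeff (pCons 0 (B $$ (i, j))) k - (\<Sum>l<n. A $$ (i, l) * coeff (B $$ (l, j)) k)"
      by (simp add: coeff_sum)
    also have "(\<Sum>l<n. A $$ (i, l) * coeff (B $$ (l, j)) k) = (A * Bk k) $$ (i, j)"
      using ij A by (auto simp: scalar_prod_def lessThan_atLeast0 Bk_def intro!: sum.cong)
    finally show ?thesis by (cases "i = j") simp_all
  qed
  define S where "S = (\<lambda>N. mat n n (\<lambda>(i, j). \<Sum>k\<le>N. coeff ?\<chi> k * (A ^\<^sub>m k) $$ (i, j)))"
  have cancel: "- U + (U - V) = - V" if "U \<in> carrier_mat n n" "V \<in> carrier_mat n n" for U V :: "'a mat"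
    using that by (intro eq_matI) auto
  have S: "S N = - (A ^\<^sub>m Suc N * Bk N)" for N
  proof (induction N)
    case 0
    show ?case
    proof (rule eq_matI)
      fix i j assume "i < dim_row (- (A ^\<^sub>m Suc 0 * Bk 0))" "j < dim_col (- (A ^\<^sub>m Suc 0 * Bk 0))"
      hence ij: "i < n" "j < n" using A by (auto simp: Bk_def)
      show "S 0 $$ (i, j) = (- (A ^\<^sub>m Suc 0 * Bk 0)) $$ (i, j)"
        using coeff[OF ij, of 0] ij A Bk[of 0] by (simp add: S_def)
    qed (use A in \<open>auto simp: S_def Bk_def\<close>)
  next
    case (Suc N)
    let ?P = "A ^\<^sub>m Suc N"
    have P: "?P \<in> carrier_mat n n" using A by (rule pow_carrier_mat)
    have "S (Suc N) = S N + coeff ?\<chi> (Suc N) \<cdot>\<^sub>m ?P"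
      using P A by (intro eq_matI) (auto simp: S_def simp del: pow_mat.simps)
    also have "coeff ?\<chi> (Suc N) \<cdot>\<^sub>m ?P = ?P * (coeff ?\<chi> (Suc N) \<cdot>\<^sub>m 1\<^sub>m n)"
      by (simp only: mult_smult_distrib[OF P one_carrier_mat] right_mult_one_mat[OF P])
    also have "coeff ?\<chi> (Suc N) \<cdot>\<^sub>m 1\<^sub>m n = Bk N - A * Bk (Suc N)"
    proof (rule eq_matI)
      fix i j assume "i < dim_row (Bk N - A * Bk (Suc N))" "j < dim_col (Bk N - A * Bk (Suc N))"
      hence ij: "i < n" "j < n" using A by (auto simp: Bk_def)
      show "(coeff ?\<chi> (Suc N) \<cdot>\<^sub>m 1\<^sub>m n) $$ (i, j) = (Bk N - A * Bk (Suc N)) $$ (i, j)"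
        using coeff[OF ij, of "Suc N"] ij A Bk by (auto simp: Bk_def)
    qed (use A in \<open>auto simp: Bk_def\<close>)
    also have "?P * (Bk N - A * Bk (Suc N)) = ?P * Bk N - ?P * (A * Bk (Suc N))"
      using A Bk by (intro mult_minus_distrib_mat[OF P]) auto
    also have "?P * (A * Bk (Suc N)) = (?P * A) * Bk (Suc N)"
      using assoc_mult_mat[OF P A Bk] by simp
    also have "S N + (?P * Bk N - (?P * A) * Bk (Suc N)) = - ((?P * A) * Bk (Suc N))"
      unfolding Suc.IH by (rule cancel[OF mult_carrier_mat[OF P Bk] mult_carrier_mat[OF mult_carrier_mat[OF P A] Bk]])
    finally show ?case by simp
  qed
  \<comment> \<open>Large enough for the partial sum to be complete and for the one term left by
    telescoping to vanish.\<close>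
  define N where "N = degree ?\<chi> + (\<Sum>i<n. \<Sum>j<n. Suc (degree (B $$ (i, j))))"
  have "Bk N = 0\<^sub>m n n"
  proof (rule eq_matI)
    fix i j assume "i < dim_row (0\<^sub>m n n :: 'a mat)" "j < dim_col (0\<^sub>m n n :: 'a mat)"
    hence ij: "i < n" "j < n" by auto
    have "Suc (degree (B $$ (i, j))) \<le> (\<Sum>j<n. Suc (degree (B $$ (i, j))))"
      using ij by (intro member_le_sum) auto
    also have "\<dots> \<le> (\<Sum>i<n. \<Sum>j<n. Suc (degree (B $$ (i, j))))"
      using ij by (intro member_le_sum[of i]) auto
    finally have "degree (B $$ (i, j)) < N" by (simp add: N_def)
    thus "Bk N $$ (i, j) = 0\<^sub>m n n $$ (i, j)" using ij by (simp add: Bk_def coeff_eq_0)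
  qed (simp_all add: Bk_def)
  hence "S N = 0\<^sub>m n n"
    using A by (simp add: S right_mult_zero_mat[of _ n n] mult_carrier_mat[of _ n n]) (auto intro!: eq_matI)
  moreover have "eval_poly_mat n ?\<chi> A = S N"
    by (intro eq_matI) (auto simp: S_def N_def eval_poly_mat_index[of _ N])
  ultimately show ?thesis by simp
qed

lemma eval_poly_mat_of_int:
  assumes "M \<in> carrier_mat n n"
  shows "eval_poly_mat n (map_poly rat_of_int g) (map_mat rat_of_int M)
    = map_mat rat_of_int (eval_poly_mat n g M)"
proof (rule eq_matI)
  fix i j assume "i < dim_row (map_mat rat_of_int (eval_poly_mat n g M))"
    "j < dim_col (map_mat rat_of_int (eval_poly_mat n g M))"
  hence ij: "i < n" "j < n" by auto
  have "(map_mat rat_of_int M ^\<^sub>m k) $$ (i, j) = rat_of_int ((M ^\<^sub>m k) $$ (i, j))" for k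
    using ij assms by (simp add: of_int_hom.mat_hom_pow[OF assms, symmetric])
  thus "eval_poly_mat n (map_poly rat_of_int g) (map_mat rat_of_int M) $$ (i, j)
      = map_mat rat_of_int (eval_poly_mat n g M) $$ (i, j)"
    using ij by (simp add: eval_poly_mat_def)
qed auto

section \<open>Companion matrices and eigenvectors\<close>

text \<open>The coefficients stand in the last row, so that the column vector of powers of a root is
  an eigenvector.\<close>

definition companion_mat :: "nat \<Rightarrow> int poly \<Rightarrow> int mat" where
  "companion_mat n P =
     mat n n (\<lambda>(i, j). if Suc i < n then (if j = Suc i then 1 else 0) else - coeff P j)"

lemma companion_mat_carrier [simp]: "companion_mat n P \<in> carrier_mat n n"
  by (simp add: companion_mat_def)

lemma companion_mat_eigenvector:
  fixes x :: "'a::field_char_0"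
  assumes P: "lead_coeff P = 1" "degree P = n" "n > 0" "poly (map_poly of_int P) x = 0"
  shows "eigenvector (map_mat of_int (companion_mat n P)) (vec n (\<lambda>i. x ^ i)) x"
  unfolding eigenvector_def
proof (intro conjI)
  show "vec n (\<lambda>i. x ^ i) \<in> carrier_vec (dim_row (map_mat of_int (companion_mat n P) :: 'a mat))"
    by (simp add: companion_mat_def)
  show "vec n (\<lambda>i. x ^ i) \<noteq> 0\<^sub>v (dim_row (map_mat of_int (companion_mat n P) :: 'a mat))"
  proof
    assume "vec n (\<lambda>i. x ^ i) = 0\<^sub>v (dim_row (map_mat of_int (companion_mat n P) :: 'a mat))"
    hence "vec n (\<lambda>i. x ^ i) $ 0 = 0\<^sub>v n $ 0" by (simp add: companion_mat_def)
    thus False using P(3) by simp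
  qed
  have "0 = (\<Sum>i\<le>n. of_int (coeff P i) * x ^ i)"
    using P by (simp add: poly_altdef)
  also have "\<dots> = (\<Sum>i<n. of_int (coeff P i) * x ^ i) + x ^ n"
    using P(1,2) by (simp add: lessThan_Suc_atMost[symmetric])
  finally have xn: "(\<Sum>i<n. - of_int (coeff P i) * x ^ i) = x ^ n"
    by (simp add: sum_negf add_eq_0_iff2 eq_commute[of 0])
  show "map_mat of_int (companion_mat n P) *\<^sub>v vec n (\<lambda>i. x ^ i) = x \<cdot>\<^sub>v vec n (\<lambda>i. x ^ i)"
  proof (rule eq_vecI)
    fix i assume "i < dim_vec (x \<cdot>\<^sub>v vec n (\<lambda>i. x ^ i))"
    hence i: "i < n" by simp
    have "(map_mat of_int (companion_mat n P) *\<^sub>v vec n (\<lambda>i. x ^ i)) $ i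
        = (\<Sum>j<n. of_int (companion_mat n P $$ (i, j)) * x ^ j)"
      using i by (auto simp: scalar_prod_def lessThan_atLeast0 companion_mat_def intro!: sum.cong)
    also have "\<dots> = x * x ^ i"
    proof (cases "Suc i < n")
      case True
      have "(\<Sum>j<n. of_int (companion_mat n P $$ (i, j)) * x ^ j) = (\<Sum>j<n. if j = Suc i then x ^ j else 0)"
        using True by (intro sum.cong) (auto simp: companion_mat_def)
      thus ?thesis using True by simp
    next
      case False
      hence n: "n = Suc i" using i by simp
      have "(\<Sum>j<n. of_int (companion_mat n P $$ (i, j)) * x ^ j) = (\<Sum>j<n. - of_int (coeff P j) * x ^ j)"
        using False i by (intro sum.cong) (auto simp: companion_mat_def)
      thus ?thesis unfolding xn using n by simp
    qed
    finally show "(map_mat of_int (companion_mat n P) *\<^sub>v vec n (\<lambda>i. x ^ i)) $ i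
        = (x \<cdot>\<^sub>v vec n (\<lambda>i. x ^ i)) $ i" using i by simp
  qed (simp add: companion_mat_def)
qed

text \<open>The characteristic polynomial is monic of degree \<open>n\<close> and vanishes at the
  eigenvalue \<open>x\<close>, hence is the minimal polynomial.\<close>

lemma char_poly_companion_mat:
  assumes p: "is_min_poly_rat (map_poly of_int P) x" and P: "lead_coeff P = 1" "degree P = n"
  shows "char_poly (map_mat rat_of_int (companion_mat n P)) = map_poly of_int P"
proof (rule is_min_poly_rat_eqI[OF p])
  let ?C = "companion_mat n P"
  let ?\<chi> = "char_poly (map_mat rat_of_int ?C)"
  have C: "map_mat of_int ?C \<in> carrier_mat n n" by simp
  have n: "n > 0" using is_min_poly_rat_degree_pos[OF p] P by simp
  have "degree ?\<chi> = n" "coeff ?\<chi> n = 1" using degree_monic_char_poly[OF C] by auto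
  thus "lead_coeff ?\<chi> = 1" "degree ?\<chi> \<le> degree (map_poly rat_of_int P)" using P by auto
  have "poly (map_poly of_int P) x = 0"
    using p by (simp add: is_min_poly_rat_def rpoly_of_int_poly del: of_int_hom.coeff_map_poly_hom)
  hence "eigenvalue (map_mat of_int ?C) x"
    using companion_mat_eigenvector[OF P n] by (auto simp: eigenvalue_def)
  hence "poly (char_poly (map_mat of_int ?C)) x = 0"
    using eigenvalue_root_char_poly[of "map_mat of_int ?C" n x] by simp
  thus "rpoly ?\<chi> x = 0"
    by (simp add: of_int_hom.char_poly_hom[of _ n] rpoly_of_int_poly)
qed

text \<open>Row \<open>i\<close> of \<open>f(M) v = f(x) v\<close>, written out because
  \<open>f(M)\<close> is rational whereas \<open>v\<close> has entries in the ambient field.\<close>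

lemma eval_poly_mat_eigenvector:
  fixes x :: "'a::field_char_0"
  assumes M: "M \<in> carrier_mat n n" and v: "eigenvector (map_mat of_int M) v x" and i: "i < n"
  shows "(\<Sum>j<n. of_rat (eval_poly_mat n f (map_mat rat_of_int M) $$ (i, j)) * vec_index v j) = rpoly f x * vec_index v i"
proof -
  have v': "v \<in> carrier_vec n" using v M by (simp add: eigenvector_def)
  let ?A = "map_mat of_int M :: 'a mat"
  have A: "?A \<in> carrier_mat n n" using M by simp
  have entry: "of_rat ((map_mat rat_of_int M ^\<^sub>m k) $$ (i, j)) = (?A ^\<^sub>m k) $$ (i, j)" if "j < n" for j k
    using i that M by (simp add: of_int_hom.mat_hom_pow[OF M, symmetric])
  have row: "(\<Sum>j<n. (?A ^\<^sub>m k) $$ (i, j) * vec_index v j) = x ^ k * vec_index v i" for k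
  proof -
    have "?A ^\<^sub>m k \<in> carrier_mat n n" using A by (rule pow_carrier_mat)
    hence "dim_row (?A ^\<^sub>m k) = n" "dim_col (?A ^\<^sub>m k) = n" by auto
    hence "(\<Sum>j<n. (?A ^\<^sub>m k) $$ (i, j) * vec_index v j) = vec_index (?A ^\<^sub>m k *\<^sub>v v) i"
      using i v' by (simp add: scalar_prod_def lessThan_atLeast0 del: pow_mat_dim)
    also have "\<dots> = x ^ k * vec_index v i"
      using eigenvector_pow[OF A v, of k] v' i by simp
    finally show ?thesis .
  qed
  have "(\<Sum>j<n. of_rat (eval_poly_mat n f (map_mat rat_of_int M) $$ (i, j)) * vec_index v j)
      = (\<Sum>j<n. \<Sum>k\<le>degree f. of_rat (coeff f k) * ((?A ^\<^sub>m k) $$ (i, j) * vec_index v j))"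
    using i by (auto simp: eval_poly_mat_def of_rat_sum of_rat_mult entry sum_distrib_right mult.assoc
        intro!: sum.cong)
  also have "\<dots> = (\<Sum>k\<le>degree f. of_rat (coeff f k) * (x ^ k * vec_index v i))"
    by (subst sum.swap) (simp add: sum_distrib_left[symmetric] row)
  also have "\<dots> = rpoly f x * vec_index v i"
    by (simp add: rpoly_altdef[OF order_refl] sum_distrib_right mult.assoc)
  finally show ?thesis .
qed

context number_field_locale
begin

text \<open>The eigenvector of powers of \<alpha> has first entry 1, so the first row of
  \<open>f\<close> at the companion matrix supplies the integer coefficients.\<close>

lemma Int_Mat_value:
  assumes f: "f \<in> Int_Mat n (M_K n K)"
    and \<alpha>: "\<alpha> \<in> O\<^sub>K" "is_min_poly_rat p \<alpha>" "degree p = n"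
  shows "\<exists>b. rpoly f \<alpha> = (\<Sum>j<n. of_int (b j) * \<alpha> ^ j)"
proof -
  obtain P where P: "p = map_poly of_int P" "lead_coeff P = 1" "degree P = degree p"
    using is_min_poly_rat_int[OF \<alpha>(2) ring_of_integersD(2)[OF \<alpha>(1)]] by blast
  let ?C = "companion_mat n P"
  have n: "n > 0" using is_min_poly_rat_degree_pos[OF \<alpha>(2)] \<alpha>(3) by simp
  have degP: "degree P = n" using P(3) \<alpha>(3) by (rule trans)
  have "char_poly (map_mat rat_of_int ?C) = p"
    unfolding P(1) using \<alpha>(2)[unfolded P(1)] P(2) degP by (rule char_poly_companion_mat)
  hence "?C \<in> M_K n K" using \<alpha> by (auto simp: M_K_def)
  then obtain B where B: "B \<in> carrier_mat n n"
      "eval_poly_mat n f (map_mat rat_of_int ?C) = map_mat rat_of_int B"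
    using f unfolding Int_Mat_def by blast
  have "poly (map_poly of_int P) \<alpha> = 0"
    using \<alpha>(2)[unfolded P(1)] unfolding is_min_poly_rat_def rpoly_of_int_poly by blast
  from eval_poly_mat_eigenvector[OF companion_mat_carrier companion_mat_eigenvector[OF P(2) degP n this] n, of f]
  have "rpoly f \<alpha> = (\<Sum>j<n. of_int (B $$ (0, j)) * \<alpha> ^ j)"
    using B n by simp
  thus ?thesis by (intro exI[of _ "\<lambda>j. B $$ (0, j)"])
qed

end

section \<open>The integral closure\<close>

text \<open>Rational root argument: write \<open>x\<close> as a reduced fraction of \<open>a\<close>
  by \<open>b\<close>. The equation times \<open>b ^ D\<close> shows that \<open>b\<close> divides
  \<open>a ^ D\<close>, so \<open>b\<close> is a unit.\<close>

lemma integral_over_polys: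
  fixes R :: "rat poly set"
  assumes "integral_over (to_fract ` R) x"
  obtains g c D where "x = to_fract g" "\<And>i. c i \<in> R" "g ^ D + (\<Sum>i<D. c i * g ^ i) = 0"
proof -
  from assms obtain p where p: "lead_coeff p = 1" "\<And>i. coeff p i \<in> to_fract ` R" "poly p x = 0"
    by (auto simp: integral_over_def)
  define D where "D = degree p"
  from p(2) have "\<exists>c. coeff p i = to_fract c \<and> c \<in> R" for i by blast
  then obtain c where c: "\<And>i. coeff p i = to_fract (c i)" "\<And>i. c i \<in> R" by metis
  have cD: "c D = 1" using p(1) c(1)[of D] by (metis D_def to_fract_1 to_fract_eq_iff)
  define a b where "a = fst (quot_of_fract x)" and "b = snd (quot_of_fract x)"
  have b0: "b \<noteq> 0" by (simp add: b_def)
  have cop: "coprime a b" unfolding a_def b_def by (rule coprime_quot_of_fract)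
  have x: "x = to_fract a / to_fract b"
    unfolding a_def b_def by (metis Fract_conv_to_fract Fract_quot_of_fract)
  have pow: "to_fract (y ^ k) = to_fract y ^ k" for y :: "rat poly" and k
    by (induction k) simp_all
  have "to_fract (\<Sum>i\<le>D. c i * a ^ i * b ^ (D - i)) = (\<Sum>i\<le>D. to_fract (c i) * x ^ i * to_fract b ^ D)"
    unfolding to_fract_sum
  proof (rule sum.cong)
    fix i assume i: "i \<in> {..D}"
    have "to_fract b ^ D = to_fract b ^ i * to_fract b ^ (D - i)"
      using i by (simp flip: power_add)
    thus "to_fract (c i * a ^ i * b ^ (D - i)) = to_fract (c i) * x ^ i * to_fract b ^ D"
      using b0 by (simp add: x pow power_divide)
  qed simp
  also have "\<dots> = poly p x * to_fract b ^ D"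
    by (simp add: poly_altdef D_def c sum_distrib_right)
  finally have "(\<Sum>i\<le>D. c i * a ^ i * b ^ (D - i)) = 0" using p(3) by (simp del: to_fract_sum)
  hence "a ^ D + (\<Sum>i<D. c i * a ^ i * b ^ (D - i)) = 0"
    by (simp add: lessThan_Suc_atMost[symmetric] cD add.commute)
  moreover have "b dvd (\<Sum>i<D. c i * a ^ i * b ^ (D - i))"
    by (intro dvd_sum dvd_mult dvd_power) auto
  ultimately have dvd: "b dvd a ^ D"
    using dvd_add_left_iff[of b "\<Sum>i<D. c i * a ^ i * b ^ (D - i)" "a ^ D"] by simp
  have "coprime (a ^ D) b" using cop by simp
  from coprime_common_divisor[OF this dvd dvd_refl] have "b dvd 1" .
  then obtain k where k: "1 = b * k" by (rule dvdE)
  define g where "g = a * k"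
  have "to_fract b * to_fract k = 1" unfolding to_fract_mult[symmetric] k[symmetric] by simp
  hence xg: "x = to_fract g" using b0 by (simp add: x g_def field_simps)
  have "to_fract (\<Sum>i\<le>D. c i * g ^ i) = poly p x"
    by (simp add: poly_altdef D_def c xg pow)
  hence "(\<Sum>i\<le>D. c i * g ^ i) = 0" using p(3) by (simp del: to_fract_sum)
  hence "g ^ D + (\<Sum>i<D. c i * g ^ i) = 0"
    by (simp add: lessThan_Suc_atMost[symmetric] cD add.commute)
  thus ?thesis using that xg c(2) by blast
qed

text \<open>The divided difference of an integer polynomial has its values in \<open>S\<close>; thus
  congruent arguments give congruent values.\<close>

lemma subring_int_poly_diff:
  assumes S: "is_subring S" and "x \<in> S" "y \<in> S"
  shows "\<exists>h\<in>S. poly (map_poly of_int G) y - poly (map_poly of_int G) x = (y - x) * h"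
proof (induction G)
  case 0
  show ?case using subring_zero[OF S] by (intro bexI[of _ 0]) auto
next
  case (pCons a G)
  let ?P = "\<lambda>x. poly (map_poly of_int G) x"
  from pCons obtain h where h: "h \<in> S" "?P y - ?P x = (y - x) * h" by blast
  have "poly (map_poly of_int (pCons a G)) y - poly (map_poly of_int (pCons a G)) x
      = y * ?P y - x * ?P x"
    by (simp add: of_int_hom.map_poly_pCons_hom)
  also have "\<dots> = y * (?P y - ?P x) + (y - x) * ?P x" by (simp add: algebra_simps)
  also have "\<dots> = (y - x) * (y * h + ?P x)" unfolding h(2) by (simp add: algebra_simps)
  finally have "poly (map_poly of_int (pCons a G)) y - poly (map_poly of_int (pCons a G)) x
      = (y - x) * (y * h + ?P x)" .
  moreover have "y * h + ?P x \<in> S"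
    using assms h(1) by (intro subring_add[OF S] subring_mult[OF S] subring_int_poly[OF S])
  ultimately show ?case by blast
qed

text \<open>Pseudo-division by a monic polynomial does not scale the dividend.\<close>

lemma monic_int_poly_division:
  fixes \<chi> :: "int poly"
  assumes "lead_coeff \<chi> = 1" "degree \<chi> > 0"
  shows "\<exists>a b. h = \<chi> * a + b \<and> degree b < degree \<chi>"
proof -
  obtain a b where ab: "pseudo_divmod h \<chi> = (a, b)" by force
  have "\<chi> \<noteq> 0" using assms by auto
  from pseudo_divmod[OF this ab] show ?thesis using assms by (intro exI[of _ a] exI[of _ b]) auto
qed

text \<open>Each Horner step multiplies by \<open>f\<close> once and so uses up one factor
  \<open>d\<close>.\<close>

lemma clear_denominators_pcompose:
  assumes "Polynomial.smult (of_int d) f = map_poly rat_of_int g"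
  shows "degree b \<le> N \<Longrightarrow>
    \<exists>G. Polynomial.smult (of_int d ^ N) (pcompose (map_poly of_int b) f) = map_poly rat_of_int G"
proof (induction b arbitrary: N)
  case 0
  show ?case by (intro exI[of _ 0]) simp
next
  case (pCons c b)
  show ?case
  proof (cases "b = 0")
    case True
    thus ?thesis
      by (intro exI[of _ "[:d ^ N * c:]"]) (simp add: of_int_hom.map_poly_pCons_hom)
  next
    case False
    then obtain N' where N: "N = Suc N'" "degree b \<le> N'" using pCons.prems by (cases N) auto
    then obtain G where G: "Polynomial.smult (of_int d ^ N') (pcompose (map_poly of_int b) f) = map_poly rat_of_int G"
      using pCons.IH by blast
    have "Polynomial.smult (of_int d ^ N) (pcompose (map_poly of_int (pCons c b)) f)
        = [:of_int (d ^ N * c):] + Polynomial.smult (of_int d) f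
            * Polynomial.smult (of_int d ^ N') (pcompose (map_poly of_int b) f)"
      by (simp add: of_int_hom.map_poly_pCons_hom pcompose_pCons N smult_add_right
          mult.commute[of "rat_of_int d"])
    also have "\<dots> = map_poly rat_of_int ([:d ^ N * c:] + g * G)"
      unfolding G assms by (simp add: of_int_poly_hom.hom_add of_int_poly_hom.hom_mult of_int_hom.map_poly_pCons_hom)
    finally show ?thesis by blast
  qed
qed

section \<open>A common multiple, modulo \<open>m\<close>, of all monic polynomials of degree
  \<open>n\<close>\<close>

definition monic_of_coeffs :: "nat \<Rightarrow> (nat \<Rightarrow> int) \<Rightarrow> int poly" where
  "monic_of_coeffs n c = (\<Sum>i<n. monom (c i) i) + monom 1 n"

lemma coeff_monic_of_coeffs:
  "coeff (monic_of_coeffs n c) i = (if i < n then c i else if i = n then 1 else 0)"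
  unfolding monic_of_coeffs_def by (simp add: coeff_sum)

lemma degree_monic_of_coeffs: "degree (monic_of_coeffs n c) = n"
  by (intro antisym degree_le le_degree) (auto simp: coeff_monic_of_coeffs)

text \<open>A monic integer polynomial of degree \<open>n\<close> that is a multiple, modulo \<open>m\<close>, of every
  monic integer polynomial of degree \<open>n\<close>.\<close>

definition universal_multiple :: "nat \<Rightarrow> int \<Rightarrow> int poly" where
  "universal_multiple n m = (\<Prod>c\<in>{..<n} \<rightarrow>\<^sub>E {0..<m}. monic_of_coeffs n c)"

lemma lead_coeff_universal_multiple: "lead_coeff (universal_multiple n m) = 1"
proof -
  have "lead_coeff (\<Prod>c\<in>C. monic_of_coeffs n c) = 1" for C
    by (induction C rule: infinite_finite_induct)
      (auto simp: lead_coeff_mult degree_monic_of_coeffs coeff_monic_of_coeffs)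
  thus ?thesis by (simp add: universal_multiple_def)
qed

text \<open>The zero tuple of coefficients contributes the factor \<open>X ^ n\<close>.\<close>

lemma degree_universal_multiple:
  assumes "m > 0"
  shows "n \<le> degree (universal_multiple n m)"
proof -
  have "restrict (\<lambda>_. 0) {..<n} \<in> {..<n} \<rightarrow>\<^sub>E {0..<m}" using assms by auto
  moreover have "finite ({..<n} \<rightarrow>\<^sub>E {0..<m})" by (intro finite_PiE) auto
  ultimately have "monic_of_coeffs n (restrict (\<lambda>_. 0) {..<n}) dvd universal_multiple n m"
    unfolding universal_multiple_def by (rule dvd_prodI[rotated])
  moreover have "universal_multiple n m \<noteq> 0" using lead_coeff_universal_multiple[of n m] by auto
  ultimately show ?thesis using dvd_imp_degree_le degree_monic_of_coeffs by metis
qed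

text \<open>Reducing the coefficients of \<chi> modulo \<open>m\<close> yields one of the factors of
  the product.\<close>

lemma universal_multiple_decomp:
  assumes \<chi>: "lead_coeff \<chi> = 1" "degree \<chi> = n" and m: "m > 0"
  shows "\<exists>Q e. universal_multiple n m = \<chi> * Q + Polynomial.smult m e"
proof -
  define c where "c = restrict (\<lambda>i. coeff \<chi> i mod m) {..<n}"
  have "c \<in> {..<n} \<rightarrow>\<^sub>E {0..<m}" using m by (auto simp: c_def)
  moreover have "finite ({..<n} \<rightarrow>\<^sub>E {0..<m})" by (intro finite_PiE) auto
  ultimately have "monic_of_coeffs n c dvd universal_multiple n m"
    unfolding universal_multiple_def by (rule dvd_prodI[rotated])
  then obtain Q where Q: "universal_multiple n m = monic_of_coeffs n c * Q" by (auto elim: dvdE)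
  define e where "e = (\<Sum>i<n. monom (coeff \<chi> i div m) i)"
  have "\<chi> = monic_of_coeffs n c + Polynomial.smult m e"
  proof (rule poly_eqI)
    fix i
    show "coeff \<chi> i = coeff (monic_of_coeffs n c + Polynomial.smult m e) i"
      using \<chi> by (auto simp: coeff_monic_of_coeffs e_def coeff_sum c_def coeff_eq_0)
  qed
  hence "universal_multiple n m = \<chi> * Q + Polynomial.smult m (- e * Q)"
    by (simp add: Q algebra_simps)
  thus ?thesis by blast
qed

context number_field_locale
begin

lemma degree_pos: "n > 0"
proof -
  have "rat_indep (\<lambda>_. 1 :: 'a) 1" by (auto simp: rat_indep_def)
  from rat_indep_le_degree[OF this] show ?thesis using subring_one[OF subring_K] by auto
qed

text \<open>With \<open>d\<close> a denominator of \<open>f\<close>, replacing \<alpha> by an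
  element congruent to it modulo \<open>d\<close> changes the value of \<open>f\<close> by an
  integral amount only; the replacement can be chosen of degree \<open>n\<close>.\<close>

lemma Int_Q_if_integral_on_generators:
  assumes gen: "\<And>\<alpha> p. \<alpha> \<in> O\<^sub>K \<Longrightarrow> is_min_poly_rat p \<alpha> \<Longrightarrow> degree p = n \<Longrightarrow> rpoly f \<alpha> \<in> O\<^sub>K"
  shows "f \<in> Int_Q O\<^sub>K"
  unfolding Int_Q_def
proof (rule CollectI, rule ballI)
  note OK = is_subring_ring_of_integers
  fix \<alpha> assume \<alpha>: "\<alpha> \<in> O\<^sub>K"
  obtain d G where dG: "d > 0" "Polynomial.smult (of_int d) f = map_poly rat_of_int G"
    using rat_poly_clear_denominators by blast
  have G: "poly (map_poly of_int G) x = of_int d * rpoly f x" for x :: 'a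
    unfolding rpoly_of_int_poly[symmetric] dG(2)[symmetric] by (simp only: rpoly_smult of_rat_of_int_eq)
  obtain \<gamma> p where \<gamma>: "\<gamma> \<in> O\<^sub>K" "is_min_poly_rat p (\<alpha> + of_int d * \<gamma>)" "degree p = n"
    using generator_in_residue_class[OF \<alpha> dG(1)] by blast
  define \<beta> where "\<beta> = \<alpha> + of_int d * \<gamma>"
  have \<beta>: "\<beta> \<in> O\<^sub>K"
    unfolding \<beta>_def by (intro subring_add[OF OK] subring_mult[OF OK] subring_of_int[OF OK] \<alpha> \<gamma>(1))
  obtain h where h: "h \<in> O\<^sub>K"
    "poly (map_poly of_int G) \<beta> - poly (map_poly of_int G) \<alpha> = (\<beta> - \<alpha>) * h"
    using subring_int_poly_diff[OF OK \<alpha> \<beta>] by blast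
  have "of_int d * (rpoly f \<beta> - rpoly f \<alpha>) = of_int d * (\<gamma> * h)"
    using h(2) unfolding G by (simp add: \<beta>_def right_diff_distrib mult.assoc)
  hence "rpoly f \<beta> - rpoly f \<alpha> = \<gamma> * h" using dG(1) by simp
  hence "rpoly f \<alpha> = rpoly f \<beta> - \<gamma> * h" by (simp add: algebra_simps)
  moreover have "rpoly f \<beta> \<in> O\<^sub>K" using gen \<beta> \<gamma> unfolding \<beta>_def by blast
  ultimately show "rpoly f \<alpha> \<in> O\<^sub>K"
    using \<gamma>(1) h(1) by (simp add: subring_diff[OF OK] subring_mult[OF OK])
qed

text \<open>At an element of degree \<open>n\<close> the coefficients of the integral equation take
  values in \<open>O\<^sub>K\<close>, so the value of \<open>g\<close> is integral over algebraic
  integers.\<close>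

lemma integral_closure_subset:
  "integral_closure (to_fract ` Int_Mat n (M_K n K)) \<subseteq> to_fract ` Int_Q O\<^sub>K"
proof
  note OK = is_subring_ring_of_integers
  fix x assume "x \<in> integral_closure (to_fract ` Int_Mat n (M_K n K))"
  hence "integral_over (to_fract ` Int_Mat n (M_K n K)) x" by (simp add: integral_closure_def)
  then obtain g c D where g: "x = to_fract g" "\<And>i. c i \<in> Int_Mat n (M_K n K)"
      "g ^ D + (\<Sum>i<D. c i * g ^ i) = 0"
    by (rule integral_over_polys) blast
  have "rpoly g \<alpha> \<in> O\<^sub>K" if \<alpha>: "\<alpha> \<in> O\<^sub>K" "is_min_poly_rat p \<alpha>" "degree p = n" for \<alpha> p
  proof -
    have cOK: "rpoly (c i) \<alpha> \<in> O\<^sub>K" for i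
    proof -
      obtain b where "rpoly (c i) \<alpha> = (\<Sum>j<n. of_int (b j) * \<alpha> ^ j)"
        using Int_Mat_value[OF g(2) \<alpha>] by blast
      thus ?thesis
        using \<alpha>(1) by (simp add: subring_sum[OF OK] subring_mult[OF OK] subring_of_int[OF OK] subring_power[OF OK])
    qed
    define q where "q = (\<Sum>i<D. monom (rpoly (c i) \<alpha>) i) + monom 1 D"
    have coeff: "coeff q i = (if i < D then rpoly (c i) \<alpha> else if i = D then 1 else 0)" for i
      unfolding q_def by (simp add: coeff_sum)
    have "degree q = D" by (intro antisym degree_le le_degree) (auto simp: coeff)
    have "poly q (rpoly g \<alpha>) = rpoly (g ^ D + (\<Sum>i<D. c i * g ^ i)) \<alpha>"
      by (simp add: q_def poly_sum poly_monom of_rat_poly.hom_add of_rat_poly.hom_sum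
          of_rat_poly.hom_mult of_rat_poly.hom_power)
    hence "poly q (rpoly g \<alpha>) = 0" by (simp add: g(3))
    moreover have "lead_coeff q = 1" by (simp add: \<open>degree q = D\<close> coeff)
    moreover have "algebraic_int (coeff q i)" for i
      unfolding coeff using ring_of_integersD(2)[OF cOK] by simp
    ultimately have "algebraic_int (rpoly g \<alpha>)" using integral_over_algebraic_ints by blast
    thus ?thesis using rpoly_in_K[OF ring_of_integersD(1)[OF \<alpha>(1)]] by (simp add: ring_of_integers_def)
  qed
  hence "g \<in> Int_Q O\<^sub>K" by (rule Int_Q_if_integral_on_generators)
  thus "x \<in> to_fract ` Int_Q O\<^sub>K" using g(1) by blast
qed

text \<open>By Cayley-Hamilton the multiple of \<open>p\<close> vanishes at a matrix with
  characteristic polynomial \<open>p\<close>; what remains has integer coefficients.\<close>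

lemma Int_MatI:
  assumes "\<And>\<alpha> p. \<alpha> \<in> O\<^sub>K \<Longrightarrow> is_min_poly_rat p \<alpha> \<Longrightarrow> degree p = n \<Longrightarrow> \<exists>w G. f = p * w + map_poly of_int G"
  shows "f \<in> Int_Mat n (M_K n K)"
  unfolding Int_Mat_def
proof (rule CollectI, rule ballI)
  fix M assume "M \<in> M_K n K"
  then obtain p \<alpha> where M: "M \<in> carrier_mat n n" and p: "\<alpha> \<in> O\<^sub>K" "is_min_poly_rat p \<alpha>" "degree p = n"
    and char: "char_poly (map_mat rat_of_int M) = p"
    by (auto simp: M_K_def)
  obtain w G where f: "f = p * w + map_poly of_int G" using assms[OF p] by blast
  let ?A = "map_mat rat_of_int M"
  have A: "?A \<in> carrier_mat n n" using M by simp
  have "eval_poly_mat n f ?A = 0\<^sub>m n n * eval_poly_mat n w ?A + map_mat rat_of_int (eval_poly_mat n G M)"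
    unfolding f eval_poly_mat_add eval_poly_mat_mult[OF A] eval_poly_mat_of_int[OF M]
    by (simp only: cayley_hamilton[OF A, unfolded char])
  also have "\<dots> = map_mat rat_of_int (eval_poly_mat n G M)"
    by (simp add: left_mult_zero_mat[of _ n n] left_add_zero_mat[of _ n n])
  finally show "eval_poly_mat n f ?A \<in> map_mat rat_of_int ` carrier_mat n n" by simp
qed

text \<open>The minimal polynomial of \<open>f(\<alpha>)\<close> is padded by a power of the
  indeterminate to the exact degree that \<open>universal_multiple_decomp\<close> expects.\<close>

lemma Int_Q_annihilator:
  assumes f: "f \<in> Int_Q O\<^sub>K" and \<alpha>: "\<alpha> \<in> O\<^sub>K"
  shows "\<exists>\<chi>. lead_coeff \<chi> = 1 \<and> degree \<chi> = n \<and> poly (map_poly of_int \<chi>) (rpoly f \<alpha>) = 0"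
proof -
  have y: "rpoly f \<alpha> \<in> O\<^sub>K" using f \<alpha> by (simp add: Int_Q_def)
  obtain q where q: "is_min_poly_rat q (rpoly f \<alpha>)"
    using min_poly_exists_K[OF ring_of_integersD(1)[OF y]] by blast
  obtain P where P: "q = map_poly of_int P" "lead_coeff P = 1" "degree P = degree q"
    using is_min_poly_rat_int[OF q ring_of_integersD(2)[OF y]] by blast
  have deg: "degree P \<le> n"
    using is_min_poly_rat_degree_le[OF q ring_of_integersD(1)[OF y]] P(3) by linarith
  have "poly (map_poly of_int P) (rpoly f \<alpha>) = 0"
    using q[unfolded P(1)] unfolding is_min_poly_rat_def rpoly_of_int_poly by blast
  moreover have "P \<noteq> 0" using P(2) by auto
  moreover have "lead_coeff (P * monom 1 (n - degree P)) = 1"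
    using P(2) by (simp only: lead_coeff_mult lead_coeff_monom)
  ultimately show ?thesis using deg
    by (intro exI[of _ "P * monom 1 (n - degree P)"])
      (simp add: degree_mult_eq degree_monom_eq of_int_poly_hom.hom_mult)
qed

text \<open>If \<open>d\<close> is a denominator of \<open>f\<close> and \<open>\<Phi>\<close> is a multiple of \<open>\<chi>\<close> modulo \<open>d\<^sup>n\<close>, then \<open>\<Phi>(f)\<close> is
  \<open>d\<^sup>n b(f)\<close> modulo \<open>\<chi>(f)\<close> with a remainder \<open>b\<close> of degree less than \<open>n\<close>, so the denominators cancel.\<close>

lemma Int_Q_universal_multiple:
  assumes f: "f \<in> Int_Q O\<^sub>K" and d: "d > 0" "Polynomial.smult (of_int d) f = map_poly rat_of_int g"
    and \<alpha>: "\<alpha> \<in> O\<^sub>K" "is_min_poly_rat p \<alpha>"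
  shows "\<exists>w G. pcompose (map_poly of_int (universal_multiple n (d ^ n))) f = p * w + map_poly of_int G"
proof -
  obtain \<chi> where \<chi>: "lead_coeff \<chi> = 1" "degree \<chi> = n" "poly (map_poly of_int \<chi>) (rpoly f \<alpha>) = 0"
    using Int_Q_annihilator[OF f \<alpha>(1)] by blast
  obtain Q e where Qe: "universal_multiple n (d ^ n) = \<chi> * Q + Polynomial.smult (d ^ n) e"
    using universal_multiple_decomp[OF \<chi>(1,2), of "d ^ n"] d(1) by auto
  obtain a b where ab: "e = \<chi> * a + b" "degree b < degree \<chi>"
    using monic_int_poly_division[OF \<chi>(1)] \<chi>(2) degree_pos by metis
  obtain G where G: "Polynomial.smult (of_int d ^ n) (pcompose (map_poly of_int b) f) = map_poly rat_of_int G"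
    using clear_denominators_pcompose[OF d(2), of b n] ab(2) \<chi>(2) by auto
  have "rpoly (pcompose (map_poly of_int \<chi>) f) \<alpha> = 0"
    by (simp add: rpoly_pcompose rpoly_of_int_poly \<chi>(3))
  then obtain w where w: "pcompose (map_poly rat_of_int \<chi>) f = p * w"
    using is_min_poly_rat_dvd[OF \<alpha>(2)] by (auto elim: dvdE)
  have "universal_multiple n (d ^ n) = \<chi> * (Q + Polynomial.smult (d ^ n) a) + Polynomial.smult (d ^ n) b"
    unfolding Qe ab(1) by (simp add: smult_add_right distrib_left)
  hence "pcompose (map_poly rat_of_int (universal_multiple n (d ^ n))) f
      = pcompose (map_poly of_int \<chi>) f * pcompose (map_poly of_int (Q + Polynomial.smult (d ^ n) a)) f
        + Polynomial.smult (of_int d ^ n) (pcompose (map_poly of_int b) f)"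
    by (simp only: of_int_poly_hom.hom_add of_int_poly_hom.hom_mult of_int_hom.map_poly_hom_smult
        pcompose_add pcompose_mult pcompose_smult of_int_power)
  also have "\<dots> = p * (w * pcompose (map_poly of_int (Q + Polynomial.smult (d ^ n) a)) f) + map_poly of_int G"
    unfolding G w by (simp only: mult.assoc)
  finally show ?thesis by blast
qed

text \<open>\<open>f\<close> is a root of the monic polynomial \<open>\<Phi>(Y) - \<Phi>(f)\<close>,
  whose constant coefficient is an integer minus \<open>\<Phi>(f)\<close>.\<close>

lemma Int_Q_subset_integral_closure:
  "to_fract ` Int_Q O\<^sub>K \<subseteq> integral_closure (to_fract ` Int_Mat n (M_K n K))"
proof
  fix x assume "x \<in> to_fract ` Int_Q O\<^sub>K"
  then obtain f where f: "f \<in> Int_Q O\<^sub>K" "x = to_fract f" by blast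
  obtain d g where d: "d > 0" "Polynomial.smult (of_int d) f = map_poly rat_of_int g"
    using rat_poly_clear_denominators by blast
  define \<Phi> where "\<Phi> = universal_multiple n (d ^ n)"
  define F where "F = pcompose (map_poly rat_of_int \<Phi>) f"
  have const: "[:of_int k:] \<in> Int_Mat n (M_K n K)" for k
    by (rule Int_MatI, intro exI[of _ 0] exI[of _ "[:k:]"]) (simp add: of_int_hom.map_poly_pCons_hom)
  have const_diff: "[:of_int k:] - F \<in> Int_Mat n (M_K n K)" for k
  proof (rule Int_MatI)
    fix \<alpha> p assume "\<alpha> \<in> O\<^sub>K" "is_min_poly_rat p \<alpha>"
    then obtain w G where "F = p * w + map_poly of_int G"
      using Int_Q_universal_multiple[OF f(1) d] unfolding F_def \<Phi>_def by blast
    hence "[:of_int k:] - F = p * (- w) + map_poly of_int ([:k:] - G)"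
      by (simp add: of_int_poly_hom.hom_minus of_int_hom.map_poly_pCons_hom)
    thus "\<exists>w G. [:of_int k:] - F = p * w + map_poly of_int G" by blast
  qed
  \<comment> \<open>Keeps the modified constant coefficient of \<open>q\<close> apart from the
    leading one.\<close>
  have deg: "degree \<Phi> > 0"
    using degree_universal_multiple[of "d ^ n" n] d(1) degree_pos by (simp add: \<Phi>_def)
  define h where "h = (\<lambda>k::int. to_fract [:rat_of_int k:])"
  have h0: "h 0 = 0" by (simp add: h_def)
  have h_add: "h (a + b) = h a + h b" and h_mult: "h (a * b) = h a * h b" for a b
    by (simp_all add: h_def flip: to_fract_add to_fract_mult)
  define q where "q = map_poly h \<Phi> - [:to_fract F:]"
  have coeff: "coeff q i = (if i = 0 then h (coeff \<Phi> 0) - to_fract F else h (coeff \<Phi> i))" for i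
    by (auto simp: q_def coeff_map_poly h0 coeff_pCons split: nat.splits)
  have inj: "h k = 0 \<longleftrightarrow> k = 0" for k by (simp add: h_def)
  have degq: "degree q = degree \<Phi>"
  proof (rule antisym)
    show "degree q \<le> degree \<Phi>"
      using deg by (intro degree_le) (auto simp: coeff coeff_eq_0 h0)
    show "degree \<Phi> \<le> degree q"
      using deg by (intro le_degree) (auto simp: coeff inj)
  qed
  have "lead_coeff q = 1"
    using deg lead_coeff_universal_multiple[of n "d ^ n"]
    by (simp add: degq coeff h_def flip: \<Phi>_def one_pCons)
  moreover have "coeff q i \<in> to_fract ` Int_Mat n (M_K n K)" for i
    using const const_diff by (auto simp: coeff h_def simp flip: to_fract_diff)
  moreover have "poly q x = 0"
  proof -
    have "poly (map_poly h P) x = to_fract (pcompose (map_poly rat_of_int P) f)" for P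
    proof (induction P)
      case (pCons a P)
      thus ?case
        by (simp add: map_poly_pCons h0 of_int_hom.map_poly_pCons_hom pcompose_pCons f(2)) (simp add: h_def)
    qed simp
    thus ?thesis by (simp add: q_def F_def)
  qed
  ultimately show "x \<in> integral_closure (to_fract ` Int_Mat n (M_K n K))"
    by (auto simp: integral_closure_def integral_over_def)
qed

end

section \<open>Failure of integral closedness\<close>

lemma dvd_diffE:
  fixes d :: "'a::comm_ring_1"
  assumes "d dvd x - y"
  obtains k where "x = y + d * k"
  using assms by (metis dvdE diff_eq_eq add.commute)

text \<open>\<open>r'\<close>, \<open>s'\<close> and \<open>t'\<close> stand for derivatives: a
  Bezout relation between \<open>r * s + d * t\<close> and its derivative becomes one between
  \<open>r\<close> and \<open>s\<close> modulo \<open>d\<close>.\<close>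

lemma bezout_rearrange:
  fixes d :: "'a::comm_ring_1"
  assumes "1 + d * l = k * (U * (r * s + d * t) + V * (r * s' + s * r' + d * t'))"
  shows "1 - r * (k * (V * s')) = s * (k * (U * r + V * r')) + d * (k * (U * t + V * t') - l)"
proof -
  have "1 - r * (k * (V * s')) = (1 + d * l) - d * l - r * (k * (V * s'))" by simp
  also have "\<dots> = s * (k * (U * r + V * r')) + d * (k * (U * t + V * t') - l)"
    unfolding assms by (simp add: algebra_simps)
  finally show ?thesis .
qed

text \<open>Modulo \<open>d\<close>, the elements \<open>r\<close> and \<open>s\<close> are coprime and \<open>s\<close> divides a power of \<open>r\<close>, so \<open>s\<close> is a
  unit.\<close>

lemma dvd_of_power_relation:
  fixes d :: "'a::comm_ring_1"
  assumes P: "P = r * s + d * t" and pow: "r ^ E = P * a + d * y"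
    and h: "h = r * b + d * z" and coprime: "1 - r * B = s * A + d * x"
  shows "\<exists>w. d dvd h - P * w"
proof -
  \<comment> \<open>The geometric sum gives \<open>1 = (1 - r * B) * C + (r * B) ^ E\<close>. Modulo
    \<open>d\<close> both summands are multiples of \<open>s\<close>, and \<open>w\<close> collects
    the cofactors.\<close>
  define C where "C = (\<Sum>i<E. (r * B) ^ i)"
  define w where "w = A * C + r * a * B ^ E"
  define x' where "x' = x * C + (t * a + y) * B ^ E"
  have "1 = (1 - r * B) * C + r ^ E * B ^ E"
    using one_diff_power_eq[of "r * B" E] by (simp add: C_def power_mult_distrib algebra_simps)
  also have "\<dots> = s * w + d * x'"
    unfolding coprime pow P w_def x'_def by (simp add: algebra_simps)
  finally have one: "s * w = 1 - d * x'" by (simp add: algebra_simps)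
  have "P * (w * b) = r * b * (s * w) + d * (t * w * b)"
    unfolding P by (simp add: algebra_simps)
  also have "\<dots> = h - d * (r * b * x' + z - t * w * b)"
    unfolding one h by (simp add: algebra_simps)
  finally have "h - P * (w * b) = d * (r * b * x' + z - t * w * b)" by simp
  thus ?thesis by (metis dvd_triv_left)
qed

text \<open>The relation \<open>bezout\<close> avoids discriminants: as \<open>q\<close> does not
  divide \<open>c\<close>, it shows that \<open>P\<close> is separable modulo
  \<open>q\<close>.\<close>

locale unramified_prime = number_field_locale K n
  for K :: "'a::field_char_0 set" and n +
  fixes \<theta> :: 'a and P U V :: "int poly" and c :: int and q :: nat
  assumes \<theta>: "\<theta> \<in> O\<^sub>K"
    and min_poly: "is_min_poly_rat (map_poly of_int P) \<theta>"
    and P_monic: "lead_coeff P = 1"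
    and P_degree: "degree P = n"
    and bezout: "U * P + V * pderiv P = [:c:]"
    and prime_q: "prime q"
    and q_not_dvd: "\<not> int q dvd c"
begin

section \<open>Congruences modulo \<open>q\<close>, and the ring \<open>Z[\<theta>]\<close> as the
  range of \<open>ev\<close>\<close>

definition qO :: "'a set" where
  "qO = (\<lambda>y. of_nat q * y) ` O\<^sub>K"

definition ev :: "int poly \<Rightarrow> 'a" where
  "ev h = poly (map_poly of_int h) \<theta>"

lemma ev_add: "ev (g + h) = ev g + ev h"
  and ev_diff: "ev (g - h) = ev g - ev h"
  and ev_mult: "ev (g * h) = ev g * ev h"
  and ev_smult: "ev (Polynomial.smult k g) = of_int k * ev g"
  and ev_monom: "ev (monom k i) = of_int k * \<theta> ^ i"
  and ev_pCons: "ev (pCons k g) = of_int k + \<theta> * ev g"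
  and ev_0: "ev 0 = 0"
  by (simp_all add: ev_def of_int_poly_hom.hom_add of_int_poly_hom.hom_minus of_int_poly_hom.hom_mult
      of_int_hom.map_poly_hom_smult poly_monom of_int_hom.map_poly_pCons_hom)

lemma ev_power: "ev (g ^ k) = ev g ^ k"
  by (induction k) (simp_all add: ev_mult, simp add: ev_def)

lemma ev_sum: "ev (\<Sum>i\<in>I. f i) = (\<Sum>i\<in>I. ev (f i))"
  by (induction I rule: infinite_finite_induct) (simp_all add: ev_0 ev_add)

lemma ev_P: "ev P = 0"
  using min_poly unfolding is_min_poly_rat_def rpoly_of_int_poly ev_def by blast

lemma ev_in: "ev g \<in> O\<^sub>K"
  unfolding ev_def by (rule subring_int_poly[OF is_subring_ring_of_integers \<theta>])

lemma ev_eq_0_small: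
  assumes "ev h = 0" "degree h < n"
  shows "h = 0"
proof -
  have "map_poly rat_of_int h = 0"
    by (rule is_min_poly_rat_unique_small[OF min_poly])
      (use assms in \<open>simp_all add: rpoly_of_int_poly ev_def P_degree\<close>)
  thus ?thesis by simp
qed

lemma divide_P: "\<exists>a b. h = P * a + b \<and> degree b < n"
  using monic_int_poly_division[OF P_monic, of h] degree_pos P_degree by simp

lemma ev_eq_0_dvd:
  assumes "ev h = 0"
  shows "P dvd h"
proof -
  obtain a b where ab: "h = P * a + b" "degree b < n" using divide_P by blast
  hence "ev b = 0" using assms by (simp add: ev_add ev_mult ev_P)
  hence "b = 0" using ab(2) by (rule ev_eq_0_small)
  thus ?thesis using ab(1) by simp
qed

lemma qO_I: "y \<in> O\<^sub>K \<Longrightarrow> of_nat q * y \<in> qO"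
  unfolding qO_def by (rule imageI)

lemma qO_subset: "x \<in> qO \<Longrightarrow> x \<in> O\<^sub>K"
  unfolding qO_def
  by (auto intro: subring_mult[OF is_subring_ring_of_integers] subring_of_nat[OF is_subring_ring_of_integers])

lemma qO_add: "x \<in> qO \<Longrightarrow> y \<in> qO \<Longrightarrow> x + y \<in> qO"
  unfolding qO_def using subring_add[OF is_subring_ring_of_integers]
  by (auto simp: distrib_left[symmetric])

lemma qO_diff: "x \<in> qO \<Longrightarrow> y \<in> qO \<Longrightarrow> x - y \<in> qO"
  unfolding qO_def using subring_diff[OF is_subring_ring_of_integers]
  by (auto simp: right_diff_distrib[symmetric])

lemma qO_mult: "x \<in> qO \<Longrightarrow> y \<in> O\<^sub>K \<Longrightarrow> y * x \<in> qO"
  unfolding qO_def using subring_mult[OF is_subring_ring_of_integers]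
  by (auto simp: mult.left_commute[of y "of_nat q" for y])

lemma qO_0: "0 \<in> qO"
  using qO_I[OF subring_zero[OF is_subring_ring_of_integers]] by simp

lemma qO_sum: "(\<And>i. i \<in> I \<Longrightarrow> f i \<in> qO) \<Longrightarrow> sum f I \<in> qO"
  by (induction I rule: infinite_finite_induct) (auto intro: qO_0 qO_add)

lemma qO_power: "x \<in> qO \<Longrightarrow> k > 0 \<Longrightarrow> x ^ k \<in> qO"
  using qO_mult[of x "x ^ (k - 1)"] qO_subset subring_power[OF is_subring_ring_of_integers]
  by (cases k) (auto simp: mult.commute)

lemma qO_cong_power:
  assumes "x \<in> O\<^sub>K" "y \<in> O\<^sub>K" "x - y \<in> qO"
  shows "x ^ k - y ^ k \<in> qO"
proof (induction k)
  case 0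
  show ?case by (simp add: qO_0)
next
  case (Suc k)
  have "x ^ Suc k - y ^ Suc k = x * (x ^ k - y ^ k) + y ^ k * (x - y)"
    by (simp add: algebra_simps)
  thus ?case
    using qO_add[OF qO_mult[OF Suc assms(1)] qO_mult[OF assms(3) subring_power[OF is_subring_ring_of_integers assms(2)]]]
    by metis
qed

section \<open>The Frobenius map modulo \<open>q\<close>\<close>

lemma frobenius_add:
  assumes x: "x \<in> O\<^sub>K" and y: "y \<in> O\<^sub>K"
  shows "(x + y) ^ q - (x ^ q + y ^ q) \<in> qO"
proof -
  note OK = is_subring_ring_of_integers
  define f where "f = (\<lambda>k. of_nat (q choose k) * x ^ k * y ^ (q - k))"
  have q: "q > 0" using prime_q by (rule prime_gt_0_nat)
  have "{..q} = insert 0 (insert q {1..<q})" using q by auto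
  hence "(x + y) ^ q = f 0 + (f q + (\<Sum>k\<in>{1..<q}. f k))"
    unfolding binomial_ring f_def[symmetric] using q by simp
  also have "f 0 = y ^ q" by (simp add: f_def)
  also have "f q = x ^ q" by (simp add: f_def)
  finally have "(x + y) ^ q - (x ^ q + y ^ q) = (\<Sum>k\<in>{1..<q}. f k)" by simp
  also have "\<dots> \<in> qO"
  proof (rule qO_sum)
    fix k assume k: "k \<in> {1..<q}"
    have "q dvd q choose k" by (rule dvd_choose_prime) (use k prime_q q in auto)
    then obtain m where m: "q choose k = q * m" by (rule dvdE)
    have "f k = of_nat q * (of_nat m * x ^ k * y ^ (q - k))" by (simp add: f_def m mult.assoc)
    moreover have "of_nat m * x ^ k * y ^ (q - k) \<in> O\<^sub>K"
      using x y by (intro subring_mult[OF OK] subring_power[OF OK] subring_of_nat[OF OK])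
    ultimately show "f k \<in> qO" by (simp add: qO_I)
  qed
  finally show ?thesis .
qed

lemma frobenius_iter_add:
  assumes x: "x \<in> O\<^sub>K" and y: "y \<in> O\<^sub>K"
  shows "(x + y) ^ (q ^ i) - (x ^ (q ^ i) + y ^ (q ^ i)) \<in> qO"
proof (induction i)
  case 0
  show ?case by (simp add: qO_0)
next
  case (Suc i)
  note OK = is_subring_ring_of_integers
  let ?a = "x ^ (q ^ i)" and ?b = "y ^ (q ^ i)" and ?z = "(x + y) ^ (q ^ i)"
  have mem: "?a \<in> O\<^sub>K" "?b \<in> O\<^sub>K" "?z \<in> O\<^sub>K" "?a + ?b \<in> O\<^sub>K"
    using x y by (auto intro!: subring_power[OF OK] subring_add[OF OK])
  have "(?z ^ q - (?a + ?b) ^ q) + ((?a + ?b) ^ q - (?a ^ q + ?b ^ q)) \<in> qO"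
    by (rule qO_add[OF qO_cong_power[OF mem(3,4) Suc] frobenius_add[OF mem(1,2)]])
  hence "?z ^ q - (?a ^ q + ?b ^ q) \<in> qO" by (simp only: add_diff_eq diff_add_cancel)
  thus ?case by (simp only: power_Suc2 power_mult)
qed

lemma frobenius_iter_diff:
  assumes x: "x \<in> O\<^sub>K" and y: "y \<in> O\<^sub>K"
  shows "(x - y) ^ (q ^ i) - (x ^ (q ^ i) - y ^ (q ^ i)) \<in> qO"
proof -
  have "(x - y) \<in> O\<^sub>K" using x y by (rule subring_diff[OF is_subring_ring_of_integers])
  from qO_diff[OF qO_0 frobenius_iter_add[OF this y, of i]] show ?thesis
    by (simp add: algebra_simps)
qed

text \<open>Nilpotency modulo \<open>q\<close> is expressed by the exponents \<open>q\<^sup>i\<close> only, since the Frobenius map makes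
  closure under addition immediate.\<close>

definition nilp :: "int poly set" where
  "nilp = {h. \<exists>i. ev h ^ (q ^ i) \<in> qO}"

section \<open>Polynomials with nilpotent value modulo \<open>q\<close>\<close>

lemma nilp_mult:
  assumes "h \<in> nilp"
  shows "a * h \<in> nilp"
proof -
  obtain i where "ev h ^ (q ^ i) \<in> qO" using assms by (auto simp: nilp_def)
  hence "ev (a * h) ^ (q ^ i) \<in> qO"
    unfolding ev_mult power_mult_distrib
    by (rule qO_mult[OF _ subring_power[OF is_subring_ring_of_integers ev_in]])
  thus ?thesis by (auto simp: nilp_def)
qed

lemma nilp_mono:
  assumes "ev h ^ (q ^ i) \<in> qO"
  shows "ev h ^ (q ^ (i + j)) \<in> qO"
  unfolding power_add power_mult using prime_gt_0_nat[OF prime_q] by (intro qO_power[OF assms]) simp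

text \<open>Both elements are raised to the common exponent \<open>q ^ (i + j)\<close>, where powers
  are additive modulo \<open>q\<close>.\<close>

lemma nilp_add:
  assumes "g \<in> nilp" "h \<in> nilp"
  shows "g + h \<in> nilp"
proof -
  obtain i j where ij: "ev g ^ (q ^ i) \<in> qO" "ev h ^ (q ^ j) \<in> qO"
    using assms by (auto simp: nilp_def)
  have "ev g ^ (q ^ (i + j)) + ev h ^ (q ^ (i + j)) \<in> qO"
    using nilp_mono[OF ij(1), of j] nilp_mono[OF ij(2), of i] by (auto simp: add.commute intro: qO_add)
  from qO_add[OF frobenius_iter_add[OF ev_in ev_in, of g h "i + j"] this]
  have "(ev g + ev h) ^ (q ^ (i + j)) \<in> qO" by (simp only: diff_add_cancel)
  thus ?thesis by (auto simp: nilp_def ev_add)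
qed

lemma nilp_diff: "g \<in> nilp \<Longrightarrow> h \<in> nilp \<Longrightarrow> g - h \<in> nilp"
  using nilp_add[of g "- 1 * h"] nilp_mult[of h "- 1"] by simp

lemma nilp_if_ev_in_qO: "ev h \<in> qO \<Longrightarrow> h \<in> nilp"
  unfolding nilp_def by (auto intro: exI[of _ 0])

lemma nilp_q: "Polynomial.smult (int q) h \<in> nilp"
  by (intro nilp_if_ev_in_qO) (simp add: ev_smult qO_I ev_in)

lemma nilp_P: "P \<in> nilp"
  by (intro nilp_if_ev_in_qO) (simp add: ev_P qO_0)

lemma inverse_mod_q:
  assumes "\<not> int q dvd k"
  shows "\<exists>a b. a * k = 1 + int q * b"
proof -
  have "coprime (int q) k" using prime_q assms by (intro prime_imp_coprime) auto
  hence "fst (bezout_coefficients (int q) k) * int q + snd (bezout_coefficients (int q) k) * k = 1"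
    using bezout_coefficients_fst_snd[of "int q" k] by simp
  thus ?thesis
    by (intro exI[of _ "snd (bezout_coefficients (int q) k)"] exI[of _ "- fst (bezout_coefficients (int q) k)"])
      (simp add: algebra_simps)
qed

text \<open>If the coefficient at \<open>N\<close> were invertible modulo \<open>q\<close>, scaling
  and subtracting a multiple of \<open>q\<close> would give a monic element of \<open>nilp\<close>
  of degree \<open>N < m\<close>; so it is divisible by \<open>q\<close> and can be removed.\<close>

lemma nilp_small_degree:
  assumes no: "\<And>r. r \<in> nilp \<Longrightarrow> lead_coeff r = 1 \<Longrightarrow> m \<le> degree r"
  shows "N \<le> m \<Longrightarrow> b \<in> nilp \<Longrightarrow> (\<forall>i\<ge>N. coeff b i = 0) \<Longrightarrow> [:int q:] dvd b"
proof (induction N arbitrary: b)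
  case 0
  hence "b = 0" by (intro poly_eqI) auto
  thus ?case by simp
next
  case (Suc N)
  show ?case
  proof (cases "int q dvd coeff b N")
    case True
    then obtain k where k: "coeff b N = int q * k" by (rule dvdE)
    define b' where "b' = b - Polynomial.smult (int q) (monom k N)"
    have "b' \<in> nilp" unfolding b'_def using Suc.prems(2) nilp_q by (rule nilp_diff)
    moreover have "coeff b' i = 0" if "i \<ge> N" for i
      using Suc.prems(3) that k by (cases "i = N") (auto simp: b'_def)
    ultimately have "[:int q:] dvd b'" using Suc.prems(1) by (intro Suc.IH) auto
    hence "[:int q:] dvd b' + [:int q:] * monom k N" by (rule dvd_add[OF _ dvd_triv_left])
    thus ?thesis by (simp add: b'_def)
  next
    case False
    then obtain k l where kl: "k * coeff b N = 1 + int q * l" using inverse_mod_q by blast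
    define b' where "b' = [:k:] * b - Polynomial.smult (int q) (monom l N)"
    have mem: "b' \<in> nilp" unfolding b'_def by (intro nilp_diff nilp_mult nilp_q Suc.prems(2))
    have coeff: "coeff b' i = (if i = N then 1 else if i > N then 0 else k * coeff b i)" for i
      using Suc.prems(3) kl by (auto simp: b'_def)
    have deg: "degree b' = N" by (intro antisym degree_le le_degree) (auto simp: coeff)
    hence "lead_coeff b' = 1" by (simp add: coeff)
    from no[OF mem this] show ?thesis using Suc.prems(1) deg by simp
  qed
qed

text \<open>Stands in for principality of ideals over the field with \<open>q\<close> elements:
  \<open>r\<close> is a monic element of least degree.\<close>

lemma nilp_generator:
  obtains r where "r \<in> nilp" "\<And>h. h \<in> nilp \<Longrightarrow> \<exists>a. [:int q:] dvd h - r * a"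
proof -
  define m where "m = (LEAST m. \<exists>r\<in>nilp. lead_coeff r = 1 \<and> degree r = m)"
  have ex: "\<exists>m. \<exists>r\<in>nilp. lead_coeff r = 1 \<and> degree r = m" using nilp_P P_monic by blast
  obtain r where r: "r \<in> nilp" "lead_coeff r = 1" "degree r = m"
    using LeastI_ex[OF ex] unfolding m_def by blast
  have least: "m \<le> degree h" if "h \<in> nilp" "lead_coeff h = 1" for h
    unfolding m_def using that by (intro Least_le) blast
  have "\<exists>a. [:int q:] dvd h - r * a" if h: "h \<in> nilp" for h
  proof (cases "m = 0")
    case True
    then obtain k where "r = [:k:]" using r(3) by (auto elim: degree_eq_zeroE)
    hence "r = 1" using r(2) by (simp add: one_pCons)
    thus ?thesis by (intro exI[of _ h]) simp
  next
    case False
    obtain a b where ab: "h = r * a + b" "degree b < m"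
      using monic_int_poly_division[OF r(2), of h] r(3) False by auto
    have "b = h - a * r" by (simp add: ab(1) mult.commute)
    hence "b \<in> nilp" using h nilp_mult[OF r(1), of a] by (simp add: nilp_diff)
    moreover have "\<forall>i\<ge>m. coeff b i = 0" using ab(2) by (auto intro: coeff_eq_0)
    ultimately have "[:int q:] dvd b" using nilp_small_degree[of m m b] least by blast
    thus ?thesis using ab(1) by (intro exI[of _ a]) simp
  qed
  thus ?thesis using that r(1) by blast
qed

text \<open>If \<open>h(\<theta>)\<close> to the power \<open>q\<^sup>i\<close> is \<open>q \<gamma>\<close>, clear denominators in an equation of integral
  dependence for \<open>\<gamma>\<close>.\<close>

lemma nilp_power:
  assumes "h \<in> nilp"
  shows "\<exists>E a. [:int q:] dvd h ^ E - P * a"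
proof -
  obtain i \<gamma> where \<gamma>: "\<gamma> \<in> O\<^sub>K" "ev h ^ (q ^ i) = of_nat q * \<gamma>"
    using assms by (auto simp: nilp_def qO_def)
  obtain G where G: "poly (map_poly of_int G) \<gamma> = 0" "lead_coeff G = 1"
    using ring_of_integersD(2)[OF \<gamma>(1)] by (auto simp: algebraic_int_altdef_ipoly)
  define D where "D = degree G"
  define g where "g = h ^ (q ^ i)"
  have evg: "ev g = of_nat q * \<gamma>" using \<gamma>(2) by (simp add: g_def ev_power)
  \<comment> \<open>The lower terms of \<open>q ^ D * G(\<gamma>)\<close> with one factor
    \<open>q\<close> taken out; the other factors turn powers of \<gamma> into powers of
    \<open>ev g\<close>.\<close>
  define W where "W = (\<Sum>k<D. Polynomial.smult (coeff G k * int q ^ (D - Suc k)) (g ^ k))"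
  have "0 = of_nat q ^ D * (\<Sum>k\<le>D. of_int (coeff G k) * \<gamma> ^ k)"
    using G(1) by (simp add: poly_altdef D_def)
  also have "\<dots> = of_nat q ^ D * \<gamma> ^ D + (\<Sum>k<D. of_nat q ^ D * (of_int (coeff G k) * \<gamma> ^ k))"
    using G(2) by (simp add: D_def lessThan_Suc_atMost[symmetric] sum_distrib_left distrib_left add.commute)
  also have "(\<Sum>k<D. of_nat q ^ D * (of_int (coeff G k) * \<gamma> ^ k)) = of_nat q * ev W"
    unfolding W_def ev_sum sum_distrib_left
  proof (rule sum.cong)
    fix k assume "k \<in> {..<D}"
    hence "D = Suc (D - Suc k) + k" by auto
    hence "of_nat q ^ D = (of_nat q * of_nat q ^ (D - Suc k) * of_nat q ^ k :: 'a)"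
      by (metis power_Suc power_add)
    thus "of_nat q ^ D * (of_int (coeff G k) * \<gamma> ^ k)
        = of_nat q * ev (Polynomial.smult (coeff G k * int q ^ (D - Suc k)) (g ^ k))"
      by (simp add: ev_smult ev_power evg power_mult_distrib mult_ac)
  qed simp
  also have "of_nat q ^ D * \<gamma> ^ D = ev (g ^ D)"
    by (simp add: ev_power evg power_mult_distrib)
  finally have "ev (g ^ D + [:int q:] * W) = 0" by (simp add: ev_add ev_smult)
  then obtain a where "g ^ D + [:int q:] * W = P * a" using ev_eq_0_dvd by (blast elim: dvdE)
  hence "g ^ D - P * a = [:int q:] * (- W)" by (simp add: algebra_simps)
  hence "h ^ (q ^ i * D) - P * a = [:int q:] * (- W)" by (simp only: g_def power_mult)
  thus ?thesis by (metis dvd_triv_left)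
qed

text \<open>With \<open>P \<equiv> r s\<close> modulo \<open>q\<close>, the relation between \<open>P\<close> and its derivative makes \<open>r\<close> and \<open>s\<close>
  coprime modulo \<open>q\<close>.\<close>

lemma nilp_subset:
  assumes h: "h \<in> nilp"
  shows "\<exists>a. [:int q:] dvd h - P * a"
proof -
  define d where "d = [:int q:]"
  obtain r where r: "r \<in> nilp" "\<And>h. h \<in> nilp \<Longrightarrow> \<exists>a. d dvd h - r * a"
    unfolding d_def by (rule nilp_generator) blast
  obtain s where "d dvd P - r * s" using r(2)[OF nilp_P] by blast
  then obtain t where s: "P = r * s + d * t" by (rule dvd_diffE)
  obtain E a where "d dvd r ^ E - P * a" using nilp_power[OF r(1)] unfolding d_def by blast
  then obtain y where y: "r ^ E = P * a + d * y" by (rule dvd_diffE)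
  obtain b where "d dvd h - r * b" using r(2)[OF h] by blast
  then obtain z where z: "h = r * b + d * z" by (rule dvd_diffE)
  \<comment> \<open>An inverse \<open>k\<close> of \<open>c\<close> modulo \<open>q\<close>
    normalizes the Bezout relation to a congruence with 1.\<close>
  obtain k l where kl: "k * c = 1 + int q * l" using inverse_mod_q[OF q_not_dvd] by blast
  have pderiv: "pderiv (r * s + d * t) = r * pderiv s + s * pderiv r + d * pderiv t"
    by (simp add: pderiv_add pderiv_mult pderiv_smult d_def)
  have "1 + d * [:l:] = [:k:] * [:c:]" using kl by (simp add: one_pCons d_def mult.commute)
  also have "\<dots> = [:k:] * (U * (r * s + d * t) + V * (r * pderiv s + s * pderiv r + d * pderiv t))"
    unfolding bezout[symmetric] pderiv[symmetric] s[symmetric] ..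
  finally have "1 - r * ([:k:] * (V * pderiv s))
      = s * ([:k:] * (U * r + V * pderiv r)) + d * ([:k:] * (U * t + V * pderiv t) - [:l:])"
    unfolding d_def[symmetric] by (rule bezout_rearrange)
  from dvd_of_power_relation[OF s y z this] show ?thesis unfolding d_def by blast
qed

text \<open>As multiples of \<open>P\<close> vanish at \<theta>, \<open>nilp_subset\<close> makes
  \<open>Z[\<theta>]\<close> reduced modulo \<open>q\<close>. In particular, an element of
  \<open>Z[\<theta>]\<close> in \<open>qO\<close> is already \<open>q\<close> times an element of
  \<open>Z[\<theta>]\<close>.\<close>

lemma ev_nilp:
  assumes "h \<in> nilp"
  shows "\<exists>b. ev h = of_nat q * ev b"
proof -
  obtain a where "[:int q:] dvd h - P * a" using nilp_subset[OF assms] by blast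
  then obtain b where "h - P * a = [:int q:] * b" by (rule dvdE)
  hence "ev (h - P * a) = of_nat q * ev b" by (simp add: ev_smult)
  thus ?thesis by (auto simp: ev_diff ev_mult ev_P)
qed

text \<open>The least positive \<open>m\<close> with \<open>m * \<beta>\<close> in
  \<open>Z[\<theta>]\<close> is prime to \<open>q\<close>, since \<open>ev_nilp\<close> would permit
  dividing by \<open>q\<close>. Inverting \<open>m\<close> modulo \<open>q\<close> gives the
  congruence.\<close>

lemma integer_cong_ev:
  assumes \<beta>: "\<beta> \<in> O\<^sub>K"
  shows "\<exists>g. \<beta> - ev g \<in> qO"
proof -
  note OK = is_subring_ring_of_integers
  define S where "S = (\<lambda>m. m > 0 \<and> (\<exists>g. of_nat m * \<beta> = ev g))"
  have "\<exists>f. \<beta> = rpoly f \<theta>"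
    by (rule degree_n_generates[OF min_poly _ ring_of_integersD(1)[OF \<theta>] ring_of_integersD(1)[OF \<beta>]])
      (simp add: P_degree)
  then obtain f where f: "\<beta> = rpoly f \<theta>" by blast
  obtain d g where d: "d > 0" "Polynomial.smult (of_int d) f = map_poly rat_of_int g"
    using rat_poly_clear_denominators by blast
  have "ev g = of_int d * \<beta>"
    unfolding f ev_def rpoly_of_int_poly[symmetric] d(2)[symmetric] by (simp only: rpoly_smult of_rat_of_int_eq)
  hence "S (nat d)" using d(1) by (auto simp: S_def intro!: exI[of _ g])
  define m where "m = (LEAST m. S m)"
  have m: "S m" unfolding m_def using \<open>S (nat d)\<close> by (rule LeastI)
  then obtain g where g: "of_nat m * \<beta> = ev g" by (auto simp: S_def)
  have "\<not> q dvd m"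
  proof
    assume "q dvd m"
    then obtain m' where m': "m = q * m'" by (rule dvdE)
    have m'\<beta>: "of_nat m' * \<beta> \<in> O\<^sub>K" using \<beta> by (intro subring_mult[OF OK] subring_of_nat[OF OK])
    have eq: "ev g = of_nat q * (of_nat m' * \<beta>)" using g by (simp add: m' mult.assoc)
    hence "g \<in> nilp" using m'\<beta> by (intro nilp_if_ev_in_qO) (simp add: qO_I)
    then obtain b where "ev g = of_nat q * ev b" using ev_nilp by blast
    hence "of_nat m' * \<beta> = ev b" using eq prime_gt_0_nat[OF prime_q] by simp
    hence "S m'" using m m' by (auto simp: S_def)
    hence "m \<le> m'" unfolding m_def by (rule Least_le)
    moreover have "m' > 0" using m m' by (auto simp: S_def)
    ultimately show False using m' prime_gt_1_nat[OF prime_q] by simp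
  qed
  hence "\<not> int q dvd int m" by simp
  then obtain a b where ab: "a * int m = 1 + int q * b" using inverse_mod_q by blast
  have "of_int (a * int m) * \<beta> = of_int (1 + int q * b) * \<beta>" by (simp only: ab)
  hence "of_int a * ev g = \<beta> + of_nat q * (of_int b * \<beta>)"
    by (simp add: g[symmetric] algebra_simps)
  hence "\<beta> - ev (Polynomial.smult a g) = of_nat q * (of_int (- b) * \<beta>)"
    by (simp add: ev_smult)
  also have "\<dots> \<in> qO" using \<beta> by (intro qO_I subring_mult[OF OK] subring_of_int[OF OK])
  finally show ?thesis by blast
qed

text \<open>Remainders modulo \<open>P\<close> have finitely many coefficient patterns modulo
  \<open>q\<close>, so two iterates \<open>\<theta> ^ (q ^ i)\<close> and
  \<open>\<theta> ^ (q ^ j)\<close> agree modulo \<open>q\<close>.\<close>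

lemma frobenius_period: "\<exists>N>0. \<theta> ^ (q ^ N) - \<theta> \<in> qO"
proof -
  note OK = is_subring_ring_of_integers
  have q: "q > 0" using prime_q by (rule prime_gt_0_nat)
  have "\<exists>b. \<theta> ^ (q ^ i) = ev b \<and> degree b < n" for i
  proof -
    obtain a b where ab: "monom 1 (q ^ i) = P * a + b" "degree b < n" using divide_P by blast
    have "\<theta> ^ (q ^ i) = ev (monom 1 (q ^ i))" by (simp add: ev_monom)
    thus ?thesis using ab by (auto simp: ab(1) ev_add ev_mult ev_P)
  qed
  then obtain b where b: "\<And>i. \<theta> ^ (q ^ i) = ev (b i)" "\<And>i. degree (b i) < n" by metis
  define \<rho> where "\<rho> = (\<lambda>i. restrict (\<lambda>k. coeff (b i) k mod int q) {..<n})"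
  have "range \<rho> \<subseteq> {..<n} \<rightarrow>\<^sub>E {0..<int q}" using q by (auto simp: \<rho>_def split: if_splits)
  moreover have "finite ({..<n} \<rightarrow>\<^sub>E {0..<int q})" by (intro finite_PiE) auto
  ultimately have "finite (range \<rho>)" by (rule finite_subset)
  hence "\<not> inj \<rho>" using range_inj_infinite by blast
  then obtain i j where ij: "\<rho> i = \<rho> j" "i < j"
    unfolding inj_def by (metis linorder_neqE_nat)
  have "[:int q:] dvd b j - b i"
  proof (subst const_poly_dvd_iff, rule allI)
    fix k
    show "int q dvd coeff (b j - b i) k"
    proof (cases "k < n")
      case True
      hence "coeff (b i) k mod int q = coeff (b j) k mod int q"
        using fun_cong[OF ij(1), of k] by (simp add: \<rho>_def)
      thus ?thesis by (simp add: mod_eq_dvd_iff[symmetric])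
    next
      case False
      thus ?thesis using b(2)[of i] b(2)[of j] by (simp add: coeff_eq_0)
    qed
  qed
  then obtain e where e: "b j - b i = [:int q:] * e" by (rule dvdE)
  have "\<theta> ^ (q ^ j) - \<theta> ^ (q ^ i) = ev (b j - b i)" by (simp add: b ev_diff)
  also have "\<dots> = of_nat q * ev e" unfolding e by (simp add: ev_smult)
  finally have diff: "\<theta> ^ (q ^ j) - \<theta> ^ (q ^ i) \<in> qO" by (simp add: qO_I ev_in)
  define N where "N = j - i"
  have "j = N + i" using ij(2) by (simp add: N_def)
  hence "(\<theta> ^ (q ^ N)) ^ (q ^ i) - \<theta> ^ (q ^ i) \<in> qO"
    using diff by (simp add: power_add power_mult)
  \<comment> \<open>Additivity pulls the common Frobenius power out of the difference, and
    reducedness then removes it.\<close>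
  from qO_add[OF frobenius_iter_diff[OF subring_power[OF OK \<theta>] \<theta>, of "q ^ N" i] this]
  have "(\<theta> ^ (q ^ N) - \<theta>) ^ (q ^ i) \<in> qO" by simp
  hence "ev (monom 1 (q ^ N) - monom 1 1) ^ (q ^ i) \<in> qO"
    by (simp add: ev_diff ev_monom)
  hence "monom 1 (q ^ N) - monom 1 1 \<in> nilp" unfolding nilp_def by blast
  then obtain g where "ev (monom 1 (q ^ N) - monom 1 1) = of_nat q * ev g" using ev_nilp by blast
  hence "\<theta> ^ (q ^ N) - \<theta> \<in> qO" by (simp add: ev_diff ev_monom qO_I ev_in)
  thus ?thesis using ij(2) by (intro exI[of _ N]) (simp add: N_def)
qed

text \<open>The fixed elements \<open>F\<close> are closed under sums and products and contain
  \<open>qO\<close>, the integers and \<theta>, hence everything congruent to an element of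
  \<open>Z[\<theta>]\<close>.\<close>

lemma frobenius_fixes_integers:
  assumes N: "\<theta> ^ (q ^ N) - \<theta> \<in> qO" and \<beta>: "\<beta> \<in> O\<^sub>K"
  shows "\<beta> ^ (q ^ N) - \<beta> \<in> qO"
proof -
  note OK = is_subring_ring_of_integers
  define Q where "Q = q ^ N"
  have Q: "Q > 0" using prime_gt_0_nat[OF prime_q] by (simp add: Q_def)
  define F where "F = (\<lambda>x. x \<in> O\<^sub>K \<and> x ^ Q - x \<in> qO)"
  have F_add: "F (x + y)" if "F x" "F y" for x y
  proof -
    have "((x + y) ^ Q - (x ^ Q + y ^ Q)) + ((x ^ Q - x) + (y ^ Q - y)) \<in> qO"
      using that unfolding F_def Q_def by (intro qO_add frobenius_iter_add) auto
    moreover have "((x + y) ^ Q - (x ^ Q + y ^ Q)) + ((x ^ Q - x) + (y ^ Q - y)) = (x + y) ^ Q - (x + y)"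
      by (simp add: algebra_simps)
    ultimately have "(x + y) ^ Q - (x + y) \<in> qO" by (simp only:)
    thus ?thesis using that by (simp add: F_def subring_add[OF OK])
  qed
  have F_mult: "F (x * y)" if "F x" "F y" for x y
  proof -
    have "x ^ Q * (y ^ Q - y) + y * (x ^ Q - x) \<in> qO"
      using that unfolding F_def by (intro qO_add qO_mult subring_power[OF OK]) auto
    thus ?thesis using that by (simp add: F_def subring_mult[OF OK] power_mult_distrib algebra_simps)
  qed
  have F_qO: "F x" if "x \<in> qO" for x
    using that Q qO_diff[OF qO_power[OF that Q] that] by (simp add: F_def qO_subset)
  have F_nat: "F (of_nat k)" for k
  proof (induction k)
    case 0
    show ?case using F_qO[OF qO_0] by simp
  next
    case (Suc k)
    have "F 1" by (simp add: F_def qO_0 subring_one[OF OK])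
    from F_add[OF this Suc] show ?case by simp
  qed
  have F_int: "F (of_int k)" for k
  proof -
    have "int (nat (k mod int q)) = k mod int q"
      using prime_gt_0_nat[OF prime_q] by simp
    hence "of_int (k mod int q) = (of_nat (nat (k mod int q)) :: 'a)"
      by (metis of_int_of_nat_eq)
    moreover have "of_int k = (of_int (k mod int q + int q * (k div int q)) :: 'a)" by simp
    ultimately have "of_int k = (of_nat (nat (k mod int q)) + of_nat q * of_int (k div int q) :: 'a)"
      by (simp only: of_int_add of_int_mult of_int_of_nat_eq)
    also have "F \<dots>" by (intro F_add F_nat F_qO qO_I subring_of_int[OF OK])
    finally show ?thesis .
  qed
  have "F \<theta>" using \<theta> N by (simp add: F_def Q_def)
  hence F_ev: "F (ev g)" for g
    by (induction g) (auto simp: ev_pCons ev_0 intro: F_add F_mult F_int F_qO qO_0)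
  obtain g where "\<beta> - ev g \<in> qO" using integer_cong_ev[OF \<beta>] by blast
  from F_add[OF F_ev F_qO[OF this], of g] show ?thesis by (simp add: F_def Q_def)
qed

lemma Int_Q_not_subset_Int_Mat:
  assumes n: "n \<ge> 2"
  shows "\<exists>f\<in>Int_Q O\<^sub>K. f \<notin> Int_Mat n (M_K n K)"
proof -
  note OK = is_subring_ring_of_integers
  have q: "q > 1" using prime_q by (rule prime_gt_1_nat)
  obtain N where N: "N > 0" "\<theta> ^ (q ^ N) - \<theta> \<in> qO" using frobenius_period by blast
  define Q where "Q = q ^ N"
  have Q: "Q > 1" unfolding Q_def using q N(1) by (rule one_less_power)
  define f where "f = Polynomial.smult (inverse (rat_of_nat q)) (monom 1 Q - monom 1 1)"
  have f: "of_nat q * rpoly f x = x ^ Q - x" for x :: 'a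
  proof -
    have "rpoly f x = inverse (of_nat q) * (x ^ Q - x)"
      unfolding f_def rpoly_smult rpoly_diff of_rat_hom.hom_inverse
      by (simp add: of_rat_hom.map_poly_hom_monom poly_monom)
    thus ?thesis using q by simp
  qed
  have "f \<in> Int_Q O\<^sub>K"
    unfolding Int_Q_def
  proof (rule CollectI, rule ballI)
    fix \<beta> assume "\<beta> \<in> O\<^sub>K"
    hence "of_nat q * rpoly f \<beta> \<in> qO"
      unfolding f Q_def by (rule frobenius_fixes_integers[OF N(2)])
    thus "rpoly f \<beta> \<in> O\<^sub>K" using q by (auto simp: qO_def)
  qed
  moreover have "f \<notin> Int_Mat n (M_K n K)"
  proof
    assume fM: "f \<in> Int_Mat n (M_K n K)"
    \<comment> \<open>Elements of \<open>Z[q \<theta>]\<close> have coefficients divisible by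
      \<open>q ^ j\<close> at \<open>\<theta> ^ j\<close>, whereas \<open>f(q \<theta>)\<close>
      contributes \<open>- \<theta>\<close>.\<close>
    define \<alpha> where "\<alpha> = of_nat q * \<theta>"
    have \<alpha>: "\<alpha> \<in> O\<^sub>K" unfolding \<alpha>_def by (intro subring_mult[OF OK] subring_of_nat[OF OK] \<theta>)
    obtain p where p: "is_min_poly_rat p \<alpha>"
      using min_poly_exists_K[OF ring_of_integersD(1)[OF \<alpha>]] by blast
    have "degree p = n"
    proof (rule antisym)
      show "degree p \<le> n" by (rule is_min_poly_rat_degree_le[OF p ring_of_integersD(1)[OF \<alpha>]])
      \<comment> \<open>\<open>p(q X)\<close> vanishes at \<theta> and has the degree of
        \<open>p\<close>, which is therefore at least \<open>n\<close>.\<close>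
      define p' where "p' = pcompose p [:0, of_nat q:]"
      have deg: "degree p' = degree p" using q by (simp add: p'_def)
      have "rpoly [:0, of_nat q:] \<theta> = \<alpha>"
        by (simp add: of_rat_hom.map_poly_pCons_hom \<alpha>_def mult.commute)
      hence "rpoly p' \<theta> = 0"
        using p by (simp add: p'_def rpoly_pcompose is_min_poly_rat_def)
      moreover have "p' \<noteq> 0" using deg is_min_poly_rat_degree_pos[OF p] by auto
      ultimately have "degree (map_poly rat_of_int P) \<le> degree p'"
        using min_poly unfolding is_min_poly_rat_def by blast
      thus "n \<le> degree p" using P_degree deg by simp
    qed
    then obtain b where b: "rpoly f \<alpha> = (\<Sum>j<n. of_int (b j) * \<alpha> ^ j)"
      using Int_Mat_value[OF fM \<alpha> p] by blast
    obtain a \<rho> where a: "monom 1 Q = P * a + \<rho>" "degree \<rho> < n" using divide_P by blast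
    have \<rho>: "ev \<rho> = \<theta> ^ Q"
      using arg_cong[OF a(1), of ev] by (simp add: ev_add ev_mult ev_P ev_monom)
    define B where "B = (\<Sum>j<n. monom (b j * int q ^ j) j)"
    have evB: "ev B = rpoly f \<alpha>"
      unfolding b B_def ev_sum by (simp add: ev_monom \<alpha>_def power_mult_distrib mult.assoc)
    \<comment> \<open>The difference of the two expressions for \<open>f(\<alpha>)\<close>, with
      \<open>\<theta> ^ Q\<close> replaced by the remainder \<rho> so that the degree stays below
      \<open>n\<close>.\<close>
    define T where "T = Polynomial.smult (int q ^ (Q - 1)) \<rho> - monom 1 1 - B"
    have "of_nat q ^ Q = (of_nat q * of_nat q ^ (Q - 1) :: 'a)"
      using Q by (simp flip: power_Suc)
    hence "of_nat q * ev T = 0"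
      using f[of \<alpha>] by (simp add: T_def ev_diff ev_smult ev_monom evB \<rho> \<alpha>_def power_mult_distrib
          right_diff_distrib mult.assoc)
    hence "ev T = 0" using q by simp
    moreover have "degree T < n"
    proof -
      have "degree B \<le> n - 1" unfolding B_def
        by (intro degree_sum_le order.trans[OF degree_monom_le]) auto
      hence "degree T \<le> n - 1"
        using a(2) n unfolding T_def
        by (intro degree_diff_le order.trans[OF degree_smult_le] order.trans[OF degree_monom_le]) auto
      thus ?thesis using n by simp
    qed
    ultimately have "T = 0" by (rule ev_eq_0_small)
    \<comment> \<open>As \<open>n \<ge> 2\<close>, no reduction modulo \<open>P\<close> touches the
      linear term \<open>- X\<close>; as \<open>Q > 1\<close>, all other contributions to this
      coefficient are divisible by \<open>q\<close>.\<close>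
    hence "coeff T 1 = 0" by simp
    moreover have "coeff B 1 = b 1 * int q" using n by (simp add: B_def coeff_sum)
    ultimately have "int q ^ (Q - 1) * coeff \<rho> 1 - b 1 * int q = 1" by (simp add: T_def)
    moreover have "int q dvd int q ^ (Q - 1) * coeff \<rho> 1 - b 1 * int q"
      using Q by (intro dvd_diff dvd_triv_right dvd_mult2[of "int q" "int q ^ (Q - 1)"] dvd_power) auto
    ultimately have "int q dvd 1" by simp
    thus False using q by simp
  qed
  ultimately show ?thesis by blast
qed

end

context number_field_locale
begin

text \<open>Clearing denominators in a Bezout relation between the minimal polynomial and its
  derivative yields \<open>c\<close>; any prime above \<open>c\<close> does not divide it.\<close>

lemma unramified_prime_exists: "\<exists>\<theta> P U V c q. unramified_prime K n \<theta> P U V c q"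
proof -
  obtain \<theta> p where \<theta>: "\<theta> \<in> O\<^sub>K" and p: "is_min_poly_rat p \<theta>" "degree p = n"
  proof -
    obtain \<gamma> p where "\<gamma> \<in> O\<^sub>K" "is_min_poly_rat p (0 + of_int 1 * \<gamma>)" "degree p = n"
      using generator_in_residue_class[OF subring_zero[OF is_subring_ring_of_integers], of 1] by auto
    thus ?thesis using that[of \<gamma> p] by simp
  qed
  obtain P where P: "p = map_poly of_int P" "lead_coeff P = 1" "degree P = degree p"
    using is_min_poly_rat_int[OF p(1) ring_of_integersD(2)[OF \<theta>]] by blast
  obtain u v where uv: "u * p + v * pderiv p = 1"
    using is_min_poly_rat_bezout[OF p(1) is_min_poly_rat_pderiv[OF p(1)]] by blast
  obtain d1 U where U: "d1 > 0" "Polynomial.smult (of_int d1) u = map_poly rat_of_int U"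
    using rat_poly_clear_denominators by blast
  obtain d2 V where V: "d2 > 0" "Polynomial.smult (of_int d2) v = map_poly rat_of_int V"
    using rat_poly_clear_denominators by blast
  define c where "c = d1 * d2"
  have "map_poly rat_of_int (Polynomial.smult d2 U * P + Polynomial.smult d1 V * pderiv P)
      = Polynomial.smult (of_int d2) (Polynomial.smult (of_int d1) u) * p
        + Polynomial.smult (of_int d1) (Polynomial.smult (of_int d2) v) * pderiv p"
    unfolding U(2) V(2) P(1)
    by (simp only: of_int_poly_hom.hom_add of_int_poly_hom.hom_mult of_int_hom.map_poly_hom_smult
        of_int_hom.map_poly_pderiv)
  also have "\<dots> = Polynomial.smult (of_int c) (u * p + v * pderiv p)"
    by (simp add: c_def smult_add_right mult.commute[of "rat_of_int d2"])
  also have "\<dots> = map_poly rat_of_int [:c:]"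
    unfolding uv by (simp add: of_int_hom.map_poly_pCons_hom)
  finally have bez: "Polynomial.smult d2 U * P + Polynomial.smult d1 V * pderiv P = [:c:]"
    by (simp only: of_int_poly_hom.eq_iff)
  obtain q where q: "prime q" "nat c < q" using bigger_prime by blast
  have "c > 0" using U(1) V(1) by (simp add: c_def)
  hence "\<not> int q dvd c" using q(2) by (auto dest: zdvd_imp_le)
  hence "unramified_prime K n \<theta> P (Polynomial.smult d2 U) (Polynomial.smult d1 V) c q"
    using \<theta> p(1)[unfolded P(1)] P(2) trans[OF P(3) p(2)] bez q(1) number_field_locale_axioms
    by (intro unramified_prime.intro unramified_prime_axioms.intro)
  thus ?thesis by blast
qed

end

text \<open>For \<open>n = 1\<close> both rings are the integer-valued polynomials and coincide, so
  failure of integral closedness is asserted from degree 2 on.\<close>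

theorem theorem3p2:
  fixes K :: "'a::field_char_0 set" and n :: nat
  assumes "number_field K" and "n = nf_degree K"
  shows "(n \<ge> 2 \<longrightarrow> \<not> integrally_closed (to_fract ` Int_Mat n (M_K n K))) \<and>
         integral_closure (to_fract ` Int_Mat n (M_K n K)) = to_fract ` Int_Q (ring_of_integers K)"
proof -
  interpret number_field_locale K n using assms by unfold_locales
  have closure: "integral_closure (to_fract ` Int_Mat n (M_K n K)) = to_fract ` Int_Q (ring_of_integers K)"
    using integral_closure_subset Int_Q_subset_integral_closure by (rule antisym)
  moreover have "\<not> integrally_closed (to_fract ` Int_Mat n (M_K n K))" if n: "n \<ge> 2"
  proof
    assume "integrally_closed (to_fract ` Int_Mat n (M_K n K))"
    hence eq: "to_fract ` Int_Q (ring_of_integers K) = to_fract ` Int_Mat n (M_K n K)"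
      using closure by (simp add: integrally_closed_def)
    obtain \<theta> P U V c q where "unramified_prime K n \<theta> P U V c q"
      using unramified_prime_exists by blast
    then interpret unramified_prime K n \<theta> P U V c q .
    obtain f where f: "f \<in> Int_Q O\<^sub>K" "f \<notin> Int_Mat n (M_K n K)"
      using Int_Q_not_subset_Int_Mat[OF n] by blast
    have "to_fract f \<in> to_fract ` Int_Mat n (M_K n K)" using f(1) eq by blast
    thus False using f(2) by auto
  qed
  ultimately show ?thesis by blast
qed

end
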